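(* Let $\mathcal H$ be a separable infinite dimensional Hilbert space, let $\mathcal{A} \subset \mathcal{B}(\mathcal{H})$ be an atomic masa and let $E$ be the normal conditional expectation onto $\mathcal A$. Let $\mathbf{S}=(S_1,\dots,S_n)$ be an $n$-tuple of commuting hermitian operators in $\mathcal B(\mathcal H)$ with finite joint spectrum $\mathcal X\subset\mathbb R^n$, such that every point of $\mathcal X$ has infinite multiplicity and such that $\mathcal X$ is the set of vertices of a convex polytope $C_{\mathcal X}\subset\mathbb{R}^n$ (so $C_{\mathcal X}$ is the convex hull of $\mathcal X$). Then $$\overline{E(\mathcal U_{\mathcal H}(\mathbf S))}^{\,\|\cdot\|} = \{ \mathbf{A} \in \mathcal{A}_{sa}^n\, : \ \sigma(\mathbf{A})\subset C_{\mathcal X}\}.$$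
   Context: An atomic masa is the algebra of operators that are diagonal with respect to a fixed orthonormal basis of $\mathcal H$; $E$ is the compression to the diagonal with respect to that basis. $\mathcal A_{sa}$ is the set of self-adjoint elements of $\mathcal A$. $\sigma(\mathbf A)\subset\mathbb R^n$ denotes the joint spectrum of the commuting tuple of hermitian operators $\mathbf A$. A point of a finite joint spectrum has infinite multiplicity if the corresponding joint eigenspace is infinite dimensional. Maps act on tuples entrywise; $\mathcal U_{\mathcal H}(\mathbf S)=\{(US_1U^*,\dots,US_nU^* ): U \text{ a unitary operator on }\mathcal H\}$ and $E(\mathcal U_{\mathcal H}(\mathbf S))=\{E(\mathbf T):\mathbf T\in\mathcal U_{\mathcal H}(\mathbf S)\}$. The closure is in the norm $\|\mathbf S\|=\max_i\|S_i\|$ (operator norm). *)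

theory Defs
  imports "HOL-Analysis.Analysis"
begin

text \<open>A complex Hilbert space, presented on top of its underlying real inner product space: the
  real inner product is the real part of the complex one, so norm, metric and topology are those
  of the library. The inner product is conjugate-linear in its first argument.\<close>

class complex_hilbert = real_inner + complete_space +
  fixes scaleC :: "complex \<Rightarrow> 'a \<Rightarrow> 'a" (infixr \<open>*\<^sub>C\<close> 75)
    and cinner :: "'a \<Rightarrow> 'a \<Rightarrow> complex"
  assumes scaleC_add_right: "c *\<^sub>C (x + y) = c *\<^sub>C x + c *\<^sub>C y"
    and scaleC_add_left: "(c + d) *\<^sub>C x = c *\<^sub>C x + d *\<^sub>C x"
    and scaleC_scaleC: "c *\<^sub>C d *\<^sub>C x = (c * d) *\<^sub>C x"
    and scaleC_of_real: "complex_of_real r *\<^sub>C x = r *\<^sub>R x"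
    and cinner_add_right: "cinner x (y + z) = cinner x y + cinner x z"
    and cinner_scaleC_right: "cinner x (c *\<^sub>C y) = c * cinner x y"
    and cinner_commute: "cinner y x = cnj (cinner x y)"
    and Re_cinner: "Re (cinner x y) = inner x y"

lemma scaleC_one: "1 *\<^sub>C x = (x :: 'h::complex_hilbert)"
  using scaleC_of_real[of 1 x] by simp

global_interpretation complex_vector: vector_space "scaleC :: complex \<Rightarrow> 'h \<Rightarrow> 'h::complex_hilbert"
  defines cspan = complex_vector.span
  by unfold_locales (simp_all add: scaleC_add_right scaleC_add_left scaleC_scaleC scaleC_one)

definition finite_cdim :: "'h::complex_hilbert set \<Rightarrow> bool" where
  "finite_cdim V \<longleftrightarrow> (\<exists>F. finite F \<and> V \<subseteq> cspan F)"

definition orthonormal_basis :: "'h::complex_hilbert set \<Rightarrow> bool" where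
  "orthonormal_basis B \<longleftrightarrow>
     (\<forall>b\<in>B. \<forall>b'\<in>B. cinner b b' = (if b = b' then 1 else 0)) \<and> closure (cspan B) = UNIV"

lemma norm_scaleC: "norm (c *\<^sub>C x) = cmod c * norm (x :: 'h::complex_hilbert)"
proof -
  have "cinner (c *\<^sub>C x) (c *\<^sub>C x) = c * cnj c * cnj (cinner x x)"
    using cinner_commute[of "c *\<^sub>C x" x] by (simp add: cinner_scaleC_right mult.assoc)
  also have "\<dots> = complex_of_real ((cmod c)\<^sup>2) * cnj (cinner x x)"
    by (simp only: complex_norm_square)
  finally have "Re (cinner (c *\<^sub>C x) (c *\<^sub>C x)) = (cmod c)\<^sup>2 * Re (cinner x x)"
    by (simp add: Re_complex_of_real del: of_real_power)
  then have "inner (c *\<^sub>C x) (c *\<^sub>C x) = (cmod c)\<^sup>2 * inner x x"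
    by (simp only: Re_cinner)
  then show ?thesis
    by (simp add: norm_eq_sqrt_inner real_sqrt_mult)
qed

text \<open>The complex bounded operators are the complex-linear elements of the library type of
  bounded real-linear maps, whose norm is the operator norm.\<close>

definition bounded_ops :: "('h::complex_hilbert \<Rightarrow>\<^sub>L 'h) set" where
  "bounded_ops = {T :: 'h \<Rightarrow>\<^sub>L 'h. \<forall>c x. T (c *\<^sub>C x) = c *\<^sub>C T x}"

definition scaleC_op :: "complex \<Rightarrow> ('h \<Rightarrow>\<^sub>L 'h) \<Rightarrow> ('h::complex_hilbert \<Rightarrow>\<^sub>L 'h)" where
  "scaleC_op c T = Blinfun (\<lambda>x. c *\<^sub>C T x)"

lemma scaleC_op_apply: "scaleC_op c T x = c *\<^sub>C T x"
proof -
  have "bounded_linear (\<lambda>x. c *\<^sub>C T x)"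
  proof (rule bounded_linear_intro[where K = "cmod c * norm T"])
    fix x y :: 'a and r :: real
    show "c *\<^sub>C T (x + y) = c *\<^sub>C T x + c *\<^sub>C T y"
      by (simp add: blinfun.add_right scaleC_add_right)
    show "c *\<^sub>C T (r *\<^sub>R x) = r *\<^sub>R c *\<^sub>C T x"
      by (simp only: blinfun.scaleR_right) (simp only: scaleC_scaleC mult.commute flip: scaleC_of_real)
    show "norm (c *\<^sub>C T x) \<le> norm x * (cmod c * norm T)"
      using mult_left_mono[OF norm_blinfun[of T x], of "cmod c"]
      by (simp add: norm_scaleC mult.commute mult.left_commute)
  qed
  then show ?thesis
    by (simp add: scaleC_op_def bounded_linear_Blinfun_apply)
qed

text \<open>By the Riesz representation theorem every bounded operator has exactly one adjoint.\<close>

definition adj_op :: "('h \<Rightarrow>\<^sub>L 'h) \<Rightarrow> ('h::complex_hilbert \<Rightarrow>\<^sub>L 'h)" where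
  "adj_op T = (THE R. R \<in> bounded_ops \<and> (\<forall>x y. cinner (R x) y = cinner x (T y)))"

definition hermitian :: "('h::complex_hilbert \<Rightarrow>\<^sub>L 'h) \<Rightarrow> bool" where
  "hermitian T \<longleftrightarrow> T \<in> bounded_ops \<and> (\<forall>x y. cinner (T x) y = cinner x (T y))"

definition unitary :: "('h::complex_hilbert \<Rightarrow>\<^sub>L 'h) \<Rightarrow> bool" where
  "unitary U \<longleftrightarrow> U \<in> bounded_ops \<and> surj (blinfun_apply U) \<and>
     (\<forall>x y. cinner (U x) (U y) = cinner x y)"

definition unital_cstar_subalgebra :: "('h::complex_hilbert \<Rightarrow>\<^sub>L 'h) set \<Rightarrow> bool" where
  "unital_cstar_subalgebra M \<longleftrightarrow>
     M \<subseteq> bounded_ops \<and> closed M \<and> id_blinfun \<in> M \<and>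
     (\<forall>T\<in>M. \<forall>R\<in>M. T + R \<in> M \<and> T o\<^sub>L R \<in> M) \<and>
     (\<forall>c. \<forall>T\<in>M. scaleC_op c T \<in> M) \<and> (\<forall>T\<in>M. adj_op T \<in> M)"

definition character_on :: "('h::complex_hilbert \<Rightarrow>\<^sub>L 'h) set \<Rightarrow> (('h \<Rightarrow>\<^sub>L 'h) \<Rightarrow> complex) \<Rightarrow> bool" where
  "character_on M \<phi> \<longleftrightarrow>
     \<phi> id_blinfun = 1 \<and>
     (\<forall>T\<in>M. \<forall>R\<in>M. \<phi> (T + R) = \<phi> T + \<phi> R \<and> \<phi> (T o\<^sub>L R) = \<phi> T * \<phi> R) \<and>
     (\<forall>c. \<forall>T\<in>M. \<phi> (scaleC_op c T) = c * \<phi> T)"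

text \<open>For a commuting tuple \<open>A\<close> of hermitian operators, the joint spectrum is the image of the
  character space of the unital C*-algebra generated by \<open>A\<close> under evaluation at \<open>A\<close>; characters
  of a C*-algebra are real on hermitian elements, so this is a subset of \<open>real ^ 'n\<close>.\<close>

definition joint_spectrum :: "('h::complex_hilbert \<Rightarrow>\<^sub>L 'h) ^ 'n \<Rightarrow> (real ^ 'n) set" where
  "joint_spectrum A =
     {\<mu>. \<exists>\<phi>. character_on (unital_cstar_subalgebra hull range (($) A)) \<phi> \<and>
            (\<forall>i. \<phi> (A $ i) = complex_of_real (\<mu> $ i))}"

definition joint_eigenspace :: "('h::complex_hilbert \<Rightarrow>\<^sub>L 'h) ^ 'n \<Rightarrow> real ^ 'n \<Rightarrow> 'h set" where
  "joint_eigenspace A \<mu> = {x. \<forall>i. (A $ i) x = (\<mu> $ i) *\<^sub>R x}"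

definition atomic_masa :: "'h::complex_hilbert set \<Rightarrow> ('h \<Rightarrow>\<^sub>L 'h) set" where
  "atomic_masa B = {T \<in> bounded_ops. \<forall>b\<in>B. \<exists>c. T b = c *\<^sub>C b}"

text \<open>The compression of \<open>T\<close> to the diagonal with respect to \<open>B\<close> is the strongly convergent sum of
  the operators \<open>P T P\<close>, where \<open>P\<close> ranges over the rank one projections onto the lines spanned by
  the elements of \<open>B\<close>; it is the diagonal operator with the same diagonal entries as \<open>T\<close>.\<close>

definition diag_compression :: "'h::complex_hilbert set \<Rightarrow> ('h \<Rightarrow>\<^sub>L 'h) \<Rightarrow> ('h \<Rightarrow>\<^sub>L 'h)" where
  "diag_compression B T = Blinfun (\<lambda>x. \<Sum>\<^sub>\<infinity>b\<in>B. (cinner b (T b) * cinner b x) *\<^sub>C b)"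

definition unitary_orbit :: "('h::complex_hilbert \<Rightarrow>\<^sub>L 'h) ^ 'n \<Rightarrow> (('h \<Rightarrow>\<^sub>L 'h) ^ 'n) set" where
  "unitary_orbit S = {(\<chi> i. U o\<^sub>L (S $ i) o\<^sub>L adj_op U) | U. unitary U}"

definition tuple_norm :: "('h::complex_hilbert \<Rightarrow>\<^sub>L 'h) ^ 'n \<Rightarrow> real" where
  "tuple_norm S = Max (range (\<lambda>i. norm (S $ i)))"

definition tuple_closure ::
    "(('h::complex_hilbert \<Rightarrow>\<^sub>L 'h) ^ 'n) set \<Rightarrow> (('h \<Rightarrow>\<^sub>L 'h) ^ 'n) set" where
  "tuple_closure X =
     {A. (\<forall>i. A $ i \<in> bounded_ops) \<and> (\<forall>\<epsilon>>0. \<exists>T\<in>X. tuple_norm (A - T) < \<epsilon>)}"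

end

theory Submission
  imports Defs
begin

text \<open>Every diagonal value of a unitary conjugate of \<open>S\<close> is a joint numerical value \<open>(\<langle>x, S\<^sub>i x\<rangle>)\<^sub>i\<close> at a
  unit vector \<open>x\<close>. If such a value were separated from \<open>C\<close> by a linear functional \<open>a\<close>, then a sequence of
  joint approximate eigenvectors realising the largest spectral value of \<open>\<Sum>\<^sub>i a\<^sub>i S\<^sub>i\<close> would induce a
  character, hence a point of the joint spectrum outside \<open>C\<close>. This gives one inclusion, as a tuple of diagonal
  operators has its joint spectrum in \<open>C\<close> if and only if its diagonal values lie in \<open>C\<close>.

  Conversely, by the theorem of Krein and Milman every point of \<open>C\<close> is the joint numerical value of a
  combination of joint eigenvectors, which by infinite multiplicity can be chosen orthogonal to any given
  finite set. An orthonormal sequence of such vectors with the prescribed diagonal values need not span the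
  space; but a rotation of a block of \<open>N\<close> of its members by an amount of order \<open>1 / \<surd>N\<close> brings one more given
  vector into the span. Working through a basis in this way yields an orthonormal basis whose diagonal values
  are uniformly close to the prescribed ones, and the corresponding unitary.\<close>

section \<open>The complex inner product\<close>

text \<open>As the joint spectrum is defined by characters, its link with vectors has to be made
  explicit. For diagonal tuples a basis vector gives a character outright; for \<open>S\<close>
  itself a character is read off from unit vectors that are eigenvectors only asymptotically, so no
  spectral decomposition enters. In the other direction a separating functional becomes a single
  operator of the generated algebra, to which a character can be applied; that characters are
  contractive is proved, since continuity is not part of their definition. What makes use of the
  closure in the converse inclusion is totality, not the diagonal values: those are attained
  exactly, but a sequence attaining them may span a proper closed subspace. Each block pays for the
  vector it absorbs with a displacement of at most 2 / sqrt N per member. The length N is fixed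
  beforehand for all blocks and each vector is moved once, so errors do not accumulate: a diagonal
  entry changes by at most 2 * norm (\<open>S $ i\<close>) * 2 / sqrt N, and the norm of a diagonal
  operator is controlled by its entries.\<close>

instance complex_hilbert \<subseteq> banach ..

lemma cinner_add_left: "cinner (x + y) z = cinner x z + cinner y (z :: 'h::complex_hilbert)"
  by (metis cinner_add_right cinner_commute complex_cnj_add)

lemma cinner_scaleC_left: "cinner (c *\<^sub>C x) y = cnj c * cinner x (y :: 'h::complex_hilbert)"
  by (metis cinner_commute cinner_scaleC_right complex_cnj_mult)

lemma cinner_scaleR_right: "cinner x (r *\<^sub>R y) = complex_of_real r * cinner x (y :: 'h::complex_hilbert)"
  by (metis cinner_scaleC_right scaleC_of_real)

lemma cinner_scaleR_left: "cinner (r *\<^sub>R x) y = complex_of_real r * cinner x (y :: 'h::complex_hilbert)"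
  by (metis cinner_scaleC_left complex_cnj_complex_of_real scaleC_of_real)

lemma cinner_self: "cinner x x = complex_of_real ((norm (x :: 'h::complex_hilbert))\<^sup>2)"
proof -
  have "Im (cinner x x) = 0"
    using cinner_commute[of x x] by (simp add: complex_eq_iff)
  then show ?thesis
    by (simp add: complex_eq_iff Re_cinner power2_norm_eq_inner del: of_real_power)
qed

lemma cmod_cinner_le: "cmod (cinner x y) \<le> norm x * norm (y :: 'h::complex_hilbert)"
proof (cases "cinner x y = 0")
  case False
  \<comment> \<open>A unimodular factor turns the complex value into its modulus, so that the real
    Cauchy-Schwarz inequality applies to \<open>x\<close> and \<open>c *\<^sub>C y\<close>.\<close>
  define c where "c = cnj (cinner x y) / cmod (cinner x y)"
  have c: "cmod c = 1" "c * cinner x y = cmod (cinner x y)"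
    using False
    by (simp_all add: c_def norm_divide mult.commute[of "cnj _"] complex_norm_square[symmetric] power2_eq_square)
  have "cmod (cinner x y) = inner x (c *\<^sub>C y)"
    by (metis Re_cinner Re_complex_of_real c(2) cinner_scaleC_right)
  also have "\<dots> \<le> norm x * norm y"
    using norm_cauchy_schwarz[of x "c *\<^sub>C y"] by (simp add: norm_scaleC c)
  finally show ?thesis .
qed simp

global_interpretation cinner: bounded_bilinear "cinner :: 'h::complex_hilbert \<Rightarrow> 'h \<Rightarrow> complex"
proof
  show "\<exists>K. \<forall>a b. cmod (cinner a (b::'h)) \<le> norm a * norm b * K"
    by (rule exI[of _ 1]) (simp add: cmod_cinner_le)
qed (simp_all add: cinner_add_left cinner_add_right cinner_scaleR_left cinner_scaleR_right scaleR_conv_of_real)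

global_interpretation scaleC: bounded_bilinear "scaleC :: complex \<Rightarrow> 'h \<Rightarrow> 'h::complex_hilbert"
proof
  fix r :: real and a :: complex and b :: 'h
  show "(r *\<^sub>R a) *\<^sub>C b = r *\<^sub>R a *\<^sub>C b" "a *\<^sub>C r *\<^sub>R b = r *\<^sub>R a *\<^sub>C b"
    by (simp_all add: scaleR_conv_of_real mult.commute scaleC_scaleC flip: scaleC_of_real)
  show "\<exists>K. \<forall>a b. norm (a *\<^sub>C b) \<le> norm a * norm (b::'h) * K"
    by (rule exI[of _ 1]) (simp add: norm_scaleC)
qed (simp_all add: scaleC_add_left scaleC_add_right)

lemma cinner_eq_0_self: "cinner x x = 0 \<longleftrightarrow> x = (0 :: 'h::complex_hilbert)"
  by (simp add: cinner_self)

lemma cinner_eq_0_commute: "cinner x y = 0 \<longleftrightarrow> cinner y (x :: 'h::complex_hilbert) = 0"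
  by (metis cinner_commute complex_cnj_zero)

lemma cinner_eqI: "(\<And>y. cinner y x = cinner y z) \<Longrightarrow> x = (z :: 'h::complex_hilbert)"
  by (metis cinner.diff_right cinner_eq_0_self right_minus_eq)

section \<open>Orthonormal families\<close>

text \<open>Families rather than sets, so that a basis (as the identity family), a finite block and
  a sequence are instances of one notion; injectivity on \<open>I\<close> follows from the
  equation.\<close>

definition orthonormal_on :: "'i set \<Rightarrow> ('i \<Rightarrow> 'h::complex_hilbert) \<Rightarrow> bool" where
  "orthonormal_on I f \<longleftrightarrow> (\<forall>i\<in>I. \<forall>j\<in>I. cinner (f i) (f j) = (if i = j then 1 else 0))"

lemma orthonormal_onD:
  "orthonormal_on I f \<Longrightarrow> i \<in> I \<Longrightarrow> j \<in> I \<Longrightarrow> cinner (f i) (f j) = (if i = j then 1 else 0)"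
  by (simp add: orthonormal_on_def)

lemma orthonormal_on_norm: "orthonormal_on I f \<Longrightarrow> i \<in> I \<Longrightarrow> norm (f i) = 1"
  using orthonormal_onD[of I f i i] cinner_self[of "f i"]
  by (simp add: power2_eq_1_iff del: of_real_power) (metis norm_ge_zero not_one_le_zero neg_0_le_iff_le)

lemma cinner_sum_right_orthonormal:
  assumes "orthonormal_on I f" "finite F" "F \<subseteq> I" "j \<in> I"
  shows "cinner (f j) (\<Sum>i\<in>F. c i *\<^sub>C f i) = (if j \<in> F then c j else 0)"
proof -
  have "cinner (f j) (\<Sum>i\<in>F. c i *\<^sub>C f i) = (\<Sum>i\<in>F. if j = i then c i else 0)"
    unfolding cinner.sum_right using assms
    by (intro sum.cong) (auto simp: cinner_scaleC_right orthonormal_onD subset_iff)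
  then show ?thesis
    using assms(2) by simp
qed

lemma cinner_sum_sum_orthonormal:
  assumes "orthonormal_on I f" "finite F" "F \<subseteq> I"
  shows "cinner (\<Sum>i\<in>F. c i *\<^sub>C f i) (\<Sum>i\<in>F. d i *\<^sub>C f i) = (\<Sum>i\<in>F. cnj (c i) * d i)"
  unfolding cinner.sum_left cinner_scaleC_left using assms
  by (intro sum.cong refl) (auto simp: cinner_sum_right_orthonormal[OF assms] subset_iff)

lemma norm_sum_orthonormal:
  assumes "orthonormal_on I f" "finite F" "F \<subseteq> I"
  shows "(norm (\<Sum>i\<in>F. c i *\<^sub>C f i))\<^sup>2 = (\<Sum>i\<in>F. (cmod (c i))\<^sup>2)"
proof -
  have "complex_of_real ((norm (\<Sum>i\<in>F. c i *\<^sub>C f i))\<^sup>2) = (\<Sum>i\<in>F. cnj (c i) * c i)"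
    unfolding cinner_self[symmetric] by (rule cinner_sum_sum_orthonormal[OF assms])
  also have "\<dots> = complex_of_real (\<Sum>i\<in>F. (cmod (c i))\<^sup>2)"
    by (simp only: of_real_sum complex_norm_square mult.commute)
  finally show ?thesis
    by (simp only: of_real_eq_iff)
qed

lemma bessel_inequality:
  assumes "orthonormal_on I f" "finite F" "F \<subseteq> I"
  shows "(\<Sum>i\<in>F. (cmod (cinner (f i) x))\<^sup>2) \<le> (norm x)\<^sup>2"
proof -
  let ?p = "\<Sum>i\<in>F. cinner (f i) x *\<^sub>C f i" and ?s = "\<Sum>i\<in>F. (cmod (cinner (f i) x))\<^sup>2"
  have "cinner ?p x = (\<Sum>i\<in>F. cnj (cinner (f i) x) * cinner (f i) x)"
    by (simp add: cinner.sum_left cinner_scaleC_left)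
  also have "\<dots> = complex_of_real ?s"
    by (simp only: of_real_sum complex_norm_square mult.commute)
  finally have "inner ?p x = ?s"
    by (metis Re_cinner Re_complex_of_real)
  moreover have "(norm ?p)\<^sup>2 = ?s"
    by (rule norm_sum_orthonormal[OF assms])
  moreover have "(norm (x - ?p))\<^sup>2 = (norm x)\<^sup>2 - 2 * inner ?p x + (norm ?p)\<^sup>2"
    unfolding power2_norm_eq_inner inner_diff_left inner_diff_right by (simp add: inner_commute)
  ultimately show ?thesis
    using zero_le_power2[of "norm (x - ?p)"] by linarith
qed

text \<open>By Pythagoras the distance between nested partial sums is the square root of a scalar
  tail, so the Cauchy criterion transfers from a bounded series of nonnegative reals.\<close>

lemma summable_on_orthonormal:
  fixes f :: "'i \<Rightarrow> 'h::complex_hilbert"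
  assumes f: "orthonormal_on I f"
    and bdd: "\<And>F. finite F \<Longrightarrow> F \<subseteq> I \<Longrightarrow> (\<Sum>i\<in>F. (cmod (c i))\<^sup>2) \<le> K"
  shows "(\<lambda>i. c i *\<^sub>C f i) summable_on I"
proof -
  let ?g = "\<lambda>i. c i *\<^sub>C f i" and ?s = "\<lambda>F. \<Sum>i\<in>F. (cmod (c i))\<^sup>2"
  have "(\<lambda>i. (cmod (c i))\<^sup>2) summable_on I"
    by (rule nonneg_bdd_above_summable_on) (auto intro!: bdd_aboveI2[where M = K] bdd)
  then have hs: "((\<lambda>i. (cmod (c i))\<^sup>2) has_sum (\<Sum>\<^sub>\<infinity>i\<in>I. (cmod (c i))\<^sup>2)) I" (is "(_ has_sum ?L) I")
    by simp
  have "\<exists>P. eventually P (finite_subsets_at_top I) \<and>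
            (\<forall>F G. P F \<and> P G \<longrightarrow> dist (sum ?g F) (sum ?g G) < e)" if e: "e > 0" for e
  proof -
    \<comment> \<open>The 5 leaves room for strictness: tails are at most
      \<open>e\<^sup>2 / 5\<close>, which is below \<open>(e / 2)\<^sup>2\<close>, and passing
      through \<open>F0\<close> costs \<open>e / 2\<close> twice.\<close>
    obtain F0 where F0: "finite F0" "F0 \<subseteq> I" "dist (?s F0) ?L \<le> e\<^sup>2 / 5"
      using has_sum_finite_approximation[OF hs, of "e\<^sup>2 / 5"] e by auto
    let ?P = "\<lambda>F. finite F \<and> F0 \<subseteq> F \<and> F \<subseteq> I"
    have near: "dist (sum ?g F) (sum ?g F0) < e / 2" if F: "?P F" for F
    proof -
      have "?s F \<le> ?L"
        using F by (intro has_sum_mono2[OF has_sum_finite hs]) auto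
      moreover have "?s (F - F0) = ?s F - ?s F0"
        using F F0 by (simp add: sum_diff)
      ultimately have "?s (F - F0) \<le> e\<^sup>2 / 5"
        using F0(3) unfolding dist_real_def by linarith
      moreover have "(dist (sum ?g F) (sum ?g F0))\<^sup>2 = ?s (F - F0)"
        using F F0(1) norm_sum_orthonormal[OF f, of "F - F0" c] by (auto simp: dist_norm sum_diff)
      moreover have "e\<^sup>2 / 5 < (e / 2)\<^sup>2"
        using e by (simp add: power2_eq_square)
      ultimately have "(dist (sum ?g F) (sum ?g F0))\<^sup>2 < (e / 2)\<^sup>2"
        by linarith
      then show ?thesis
        by (rule power2_less_imp_less) (use e in simp)
    qed
    have "eventually ?P (finite_subsets_at_top I)"
      using F0 by (auto simp: eventually_finite_subsets_at_top)
    moreover have "dist (sum ?g F) (sum ?g G) < e" if "?P F" "?P G" for F G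
      using near[OF that(1)] near[OF that(2)] by (rule dist_triangle_half_l)
    ultimately show ?thesis
      by (intro exI[of _ ?P] conjI allI impI) auto
  qed
  then have "cauchy_filter (filtermap (sum ?g) (finite_subsets_at_top I))"
    by (simp add: cauchy_filter_metric_filtermap)
  moreover have "complete (UNIV :: 'h set)"
    by (meson Cauchy_convergent UNIV_I complete_def convergent_def)
  ultimately obtain L' where "(sum ?g \<longlongrightarrow> L') (finite_subsets_at_top I)"
    using complete_uniform[where S=UNIV] by (force simp add: filterlim_def)
  then show ?thesis
    using summable_on_def has_sum_def by blast
qed

text \<open>One construction serves three purposes: adjoints (\<open>h b = T b\<close>), diagonal
  operators (\<open>h b\<close> a multiple of \<open>b\<close>) and unitaries (\<open>h\<close> and
  \<open>g\<close> two orthonormal bases). The bound on the coefficients plays the role of Bessel's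
  inequality for \<open>h\<close> and gives both convergence and the norm estimate.\<close>

lemma synthesis_operator:
  fixes g h :: "'i \<Rightarrow> 'h::complex_hilbert"
  assumes g: "orthonormal_on I g" and K: "K \<ge> 0"
    and bdd: "\<And>F x. finite F \<Longrightarrow> F \<subseteq> I \<Longrightarrow> (\<Sum>i\<in>F. (cmod (cinner (h i) x))\<^sup>2) \<le> (K * norm x)\<^sup>2"
  shows "\<exists>D\<in>bounded_ops. norm D \<le> K \<and>
    (\<forall>x. blinfun_apply D x = (\<Sum>\<^sub>\<infinity>i\<in>I. cinner (h i) x *\<^sub>C g i)) \<and>
    (\<forall>j\<in>I. \<forall>x. cinner (g j) (blinfun_apply D x) = cinner (h j) x)"
proof -
  define T where "T x = (\<Sum>\<^sub>\<infinity>i\<in>I. cinner (h i) x *\<^sub>C g i)" for x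
  have summ: "(\<lambda>i. cinner (h i) x *\<^sub>C g i) summable_on I" for x
    by (rule summable_on_orthonormal[OF g bdd])
  have hs: "((\<lambda>i. cinner (h i) x *\<^sub>C g i) has_sum T x) I" for x
    unfolding T_def using summ by simp
  have add: "T (x + y) = T x + T y" for x y
    using has_sum_add[OF hs[of x] hs[of y]]
    by (intro has_sum_unique[OF hs[of "x + y"]]) (simp add: cinner_add_right scaleC_add_left)
  have scaleC: "T (c *\<^sub>C x) = c *\<^sub>C T x" for c x
    using has_sum_bounded_linear[OF scaleC.bounded_linear_right[of c] hs[of x]]
    by (intro has_sum_unique[OF hs[of "c *\<^sub>C x"]]) (simp add: cinner_scaleC_right scaleC_scaleC)
  have le: "norm (T x) \<le> norm x * K" for x
  proof -
    have "norm (\<Sum>i\<in>F. cinner (h i) x *\<^sub>C g i) \<le> K * norm x" if "finite F" "F \<subseteq> I" for F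
      by (rule power2_le_imp_le)
        (simp_all only: norm_sum_orthonormal[OF g that] bdd[OF that] K mult_nonneg_nonneg norm_ge_zero)
    then have ev: "eventually (\<lambda>F. norm (\<Sum>i\<in>F. cinner (h i) x *\<^sub>C g i) \<le> K * norm x) (finite_subsets_at_top I)"
      by (intro eventually_finite_subsets_at_top_weakI) auto
    have lim: "((\<lambda>F. norm (\<Sum>i\<in>F. cinner (h i) x *\<^sub>C g i)) \<longlongrightarrow> norm (T x)) (finite_subsets_at_top I)"
      using hs[of x] unfolding has_sum_def by (rule tendsto_norm)
    show ?thesis
      using tendsto_upperbound[OF lim ev] by (simp add: mult.commute)
  qed
  have bl: "bounded_linear T"
  proof (rule bounded_linear_intro[OF add _ le])
    show "T (r *\<^sub>R x) = r *\<^sub>R T x" for r x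
      using scaleC[of "complex_of_real r" x] by (simp only: scaleC_of_real)
  qed
  let ?D = "Blinfun T"
  have D: "?D x = T x" for x
    using bl by (simp add: bounded_linear_Blinfun_apply)
  show ?thesis
  proof (intro bexI[of _ ?D] conjI ballI allI)
    show "?D \<in> bounded_ops"
      by (simp add: bounded_ops_def D scaleC)
    show "norm ?D \<le> K"
      using le by (intro norm_blinfun_bound K) (simp add: D mult.commute)
    show "?D x = (\<Sum>\<^sub>\<infinity>i\<in>I. cinner (h i) x *\<^sub>C g i)" for x
      by (simp add: D T_def)
    show "cinner (g j) (?D x) = cinner (h j) x" if j: "j \<in> I" for x j
    proof -
      have "((\<lambda>i. cinner (g j) (cinner (h i) x *\<^sub>C g i)) has_sum cinner (g j) (T x)) I"
        by (rule has_sum_bounded_linear[OF cinner.bounded_linear_right hs])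
      moreover have "((\<lambda>i. cinner (g j) (cinner (h i) x *\<^sub>C g i)) has_sum cinner (h j) x) I"
      proof (rule has_sum_finite_neutralI[where B="{j}"])
      qed (use g j in \<open>auto simp: cinner_scaleC_right orthonormal_onD\<close>)
      ultimately show ?thesis
        unfolding D by (rule has_sum_unique)
    qed
  qed
qed

section \<open>Bounded operators and adjoints\<close>

lemma bounded_opsD: "T \<in> bounded_ops \<Longrightarrow> T (c *\<^sub>C x) = c *\<^sub>C T x"
  by (simp add: bounded_ops_def)

lemma bounded_ops_add: "T \<in> bounded_ops \<Longrightarrow> R \<in> bounded_ops \<Longrightarrow> T + R \<in> bounded_ops"
  by (simp add: bounded_ops_def blinfun.add_left scaleC_add_right)

lemma bounded_ops_diff: "T \<in> bounded_ops \<Longrightarrow> R \<in> bounded_ops \<Longrightarrow> T - R \<in> bounded_ops"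
  by (simp add: bounded_ops_def blinfun.diff_left scaleC.diff_right)

lemma bounded_ops_compose: "T \<in> bounded_ops \<Longrightarrow> R \<in> bounded_ops \<Longrightarrow> T o\<^sub>L R \<in> bounded_ops"
  by (simp add: bounded_ops_def)

lemma bounded_ops_scaleC: "T \<in> bounded_ops \<Longrightarrow> scaleC_op c T \<in> bounded_ops"
  by (simp add: bounded_ops_def scaleC_op_apply scaleC_scaleC mult.commute)

lemma bounded_ops_id: "id_blinfun \<in> bounded_ops"
  by (simp add: bounded_ops_def)

lemma closed_bounded_ops: "closed (bounded_ops :: ('h::complex_hilbert \<Rightarrow>\<^sub>L 'h) set)"
proof -
  have eq: "bounded_ops = (\<Inter>c. \<Inter>x. {T :: 'h \<Rightarrow>\<^sub>L 'h. T (c *\<^sub>C x) = c *\<^sub>C T x})"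
    by (auto simp: bounded_ops_def)
  show ?thesis
    unfolding eq by (intro closed_INT ballI closed_Collect_eq continuous_intros scaleC.continuous_on)
qed

lemma norm_scaleC_op: "norm (scaleC_op c T) \<le> cmod c * norm T"
  by (rule norm_blinfun_bound)
    (auto simp: scaleC_op_apply norm_scaleC mult.assoc intro!: mult_left_mono norm_blinfun)

text \<open>The vectors satisfying \<open>P\<close> form a closed subspace containing a total set.
  In the applications \<open>P\<close> is an equation between continuous functions, which makes it
  closed.\<close>

lemma total_induct [consumes 1, case_names closed zero base add scale]:
  assumes "closure (cspan A) = (UNIV :: 'h::complex_hilbert set)"
    and "closed {x. P x}" "P 0" "\<And>b. b \<in> A \<Longrightarrow> P b"
    and "\<And>x y. P x \<Longrightarrow> P y \<Longrightarrow> P (x + y)" "\<And>c x. P x \<Longrightarrow> P (c *\<^sub>C x)"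
  shows "P x"
proof -
  have "complex_vector.subspace {x. P x}"
    using assms by (auto simp: complex_vector.subspace_def)
  then have "cspan A \<subseteq> {x. P x}"
    using assms(4) by (intro complex_vector.span_minimal) auto
  then have "closure (cspan A) \<subseteq> {x. P x}"
    by (rule closure_minimal[OF _ assms(2)])
  then show ?thesis
    using assms(1) by auto
qed

lemma bounded_ops_eqI:
  assumes "closure (cspan A) = UNIV" "T \<in> bounded_ops" "R \<in> bounded_ops" "\<And>b. b \<in> A \<Longrightarrow> T b = R b"
  shows "T = R"
proof (rule blinfun_eqI)
  show "T x = R x" for x
    using assms(1)
  proof (induction x rule: total_induct)
    case closed
    show ?case
      by (intro closed_Collect_eq continuous_intros)
  qed (use assms in \<open>simp_all add: blinfun.add_right bounded_opsD blinfun.zero_right\<close>)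
qed

lemma adjointI:
  assumes "closure (cspan A) = UNIV" "closure (cspan A') = UNIV" "T \<in> bounded_ops" "R \<in> bounded_ops"
    and "\<And>a a'. a \<in> A \<Longrightarrow> a' \<in> A' \<Longrightarrow> cinner (R a) a' = cinner a (T a')"
  shows "cinner (R x) y = cinner x (T y)"
proof -
  have 1: "cinner (R x) a = cinner x (T a)" if a: "a \<in> A'" for x a
    using assms(1)
  proof (induction x rule: total_induct)
    case closed
    show ?case
      by (intro closed_Collect_eq continuous_intros cinner.continuous_on)
  qed (use assms(3-) a in \<open>simp_all add: blinfun.add_right bounded_opsD blinfun.zero_right
        cinner.zero_left cinner_add_left cinner_scaleC_left\<close>)
  show ?thesis
    using assms(2)
  proof (induction y rule: total_induct)
    case closed
    show ?case
      by (intro closed_Collect_eq continuous_intros cinner.continuous_on)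
  qed (use assms(3-4) in \<open>simp_all add: 1 blinfun.add_right bounded_opsD blinfun.zero_right
        cinner.zero_right cinner_add_right cinner_scaleC_right\<close>)
qed

lemma adj_op_eqI:
  fixes T :: "'h::complex_hilbert \<Rightarrow>\<^sub>L 'h"
  assumes "R \<in> bounded_ops" "\<And>x y. cinner (R x) y = cinner x (T y)"
  shows "adj_op T = R"
  unfolding adj_op_def
proof (rule the_equality)
  fix Q
  assume Q: "Q \<in> bounded_ops \<and> (\<forall>x y. cinner (Q x) y = cinner x (T y))"
  show "Q = R"
  proof (rule blinfun_eqI, rule cinner_eqI)
    show "cinner y (Q x) = cinner y (R x)" for x y
      using Q assms(2) by (metis cinner_commute)
  qed
qed (use assms in simp)

lemma orthonormal_basis_orthonormal_on: "orthonormal_basis B \<Longrightarrow> orthonormal_on B (\<lambda>b. b)"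
  by (simp add: orthonormal_basis_def orthonormal_on_def)

lemma orthonormal_basis_total: "orthonormal_basis B \<Longrightarrow> closure (cspan B) = UNIV"
  by (simp add: orthonormal_basis_def)

lemma total_cinner_eqI:
  assumes "closure (cspan A) = UNIV" "\<And>a. a \<in> A \<Longrightarrow> cinner a x = cinner a z"
  shows "x = z"
proof (rule cinner_eqI)
  show "cinner y x = cinner y z" for y
    using assms(1)
  proof (induction y rule: total_induct)
    case closed
    show ?case
      by (intro closed_Collect_eq continuous_intros cinner.continuous_on)
  qed (use assms in \<open>simp_all add: cinner.zero_left cinner_add_left cinner_scaleC_left\<close>)
qed

lemmas orthonormal_basis_cinner_eqI = total_cinner_eqI[OF orthonormal_basis_total]

text \<open>In coordinates the adjoint must send \<open>x\<close> to the vector with coefficients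
  \<open>cinner (T b) x\<close>. For a finite part \<open>u\<close> of that vector,
  \<open>norm u * norm u = inner (T u) x\<close>, which is at most
  \<open>norm T * norm u * norm x\<close>; cancelling \<open>norm u\<close> yields the bound needed
  for convergence. The rules for \<open>adj_op\<close> below assume a basis because existence of the
  adjoint comes from here.\<close>

lemma adjoint_exists:
  fixes T :: "'h::complex_hilbert \<Rightarrow>\<^sub>L 'h" and B :: "'h set"
  assumes B: "orthonormal_basis B" and T: "T \<in> bounded_ops"
  obtains R where "R \<in> bounded_ops" "norm R \<le> norm T" "\<And>x y. cinner (R x) y = cinner x (T y)"
proof -
  note on = orthonormal_basis_orthonormal_on[OF B]
  have bdd: "(\<Sum>b\<in>F. (cmod (cinner (T b) x))\<^sup>2) \<le> (norm T * norm x)\<^sup>2" if F: "finite F" "F \<subseteq> B" for F x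
  proof -
    define u where "u = (\<Sum>b\<in>F. cinner (T b) x *\<^sub>C b)"
    let ?s = "\<Sum>b\<in>F. (cmod (cinner (T b) x))\<^sup>2"
    have u: "(norm u)\<^sup>2 = ?s"
      unfolding u_def by (rule norm_sum_orthonormal[OF on F])
    have "cinner (T u) x = (\<Sum>b\<in>F. cnj (cinner (T b) x) * cinner (T b) x)"
      by (simp add: u_def blinfun.sum_right bounded_opsD[OF T] cinner.sum_left cinner_scaleC_left)
    also have "\<dots> = complex_of_real ?s"
      by (simp only: of_real_sum complex_norm_square mult.commute)
    finally have "inner (T u) x = ?s"
      by (metis Re_cinner Re_complex_of_real)
    then have "norm u * norm u \<le> norm (T u) * norm x"
      using norm_cauchy_schwarz[of "T u" x] u by (simp add: power2_eq_square)
    also have "\<dots> \<le> norm T * norm u * norm x"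
      by (intro mult_right_mono norm_blinfun) simp
    finally have "norm u \<le> norm T * norm x"
      by (cases "u = 0") (simp_all add: mult.commute mult.left_commute)
    then show ?thesis
      unfolding u[symmetric] by (rule power_mono) simp
  qed
  note tot = orthonormal_basis_total[OF B]
  from synthesis_operator[OF on norm_ge_zero bdd]
  obtain R :: "'h \<Rightarrow>\<^sub>L 'h" where R: "R \<in> bounded_ops" "norm R \<le> norm T"
    "\<forall>b\<in>B. \<forall>x. cinner b (R x) = cinner (T b) x"
    by blast
  show thesis
  proof (rule that[OF R(1,2)])
    show "cinner (R x) y = cinner x (T y)" for x y
      by (rule adjointI[OF tot tot T R(1)]) (metis R(3) cinner_commute)
  qed
qed

context
  fixes B :: "'h::complex_hilbert set"
  assumes B: "orthonormal_basis B"
begin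

lemma adj_op_bounded_ops: "T \<in> bounded_ops \<Longrightarrow> adj_op T \<in> (bounded_ops :: ('h \<Rightarrow>\<^sub>L 'h) set)"
  by (metis adjoint_exists[OF B] adj_op_eqI)

lemma cinner_adj_op_left: "T \<in> bounded_ops \<Longrightarrow> cinner (adj_op T x) y = cinner x (T (y :: 'h))"
  by (metis adjoint_exists[OF B] adj_op_eqI)

lemma cinner_adj_op_right:
  assumes "T \<in> bounded_ops"
  shows "cinner x (adj_op T y) = cinner (T x) (y :: 'h)"
  by (subst (1 2) cinner_commute) (simp add: cinner_adj_op_left[OF assms])

lemma norm_adj_op_le: "T \<in> bounded_ops \<Longrightarrow> norm (adj_op T :: 'h \<Rightarrow>\<^sub>L 'h) \<le> norm T"
  by (metis adjoint_exists[OF B] adj_op_eqI)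

lemma adj_op_adj_op: "T \<in> bounded_ops \<Longrightarrow> adj_op (adj_op T) = (T :: 'h \<Rightarrow>\<^sub>L 'h)"
  by (rule adj_op_eqI) (simp_all add: cinner_adj_op_right)

lemma adj_op_add:
  assumes "T \<in> bounded_ops" "R \<in> bounded_ops"
  shows "adj_op (T + R) = adj_op T + (adj_op R :: 'h \<Rightarrow>\<^sub>L 'h)"
  using assms by (intro adj_op_eqI)
    (simp_all add: bounded_ops_add adj_op_bounded_ops blinfun.add_left cinner_add_left cinner_add_right cinner_adj_op_left)

lemma adj_op_diff:
  assumes "T \<in> bounded_ops" "R \<in> bounded_ops"
  shows "adj_op (T - R) = adj_op T - (adj_op R :: 'h \<Rightarrow>\<^sub>L 'h)"
  using assms by (intro adj_op_eqI)
    (simp_all add: bounded_ops_diff adj_op_bounded_ops blinfun.diff_left cinner.diff_left cinner.diff_right cinner_adj_op_left)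

lemma adj_op_compose:
  assumes "T \<in> bounded_ops" "R \<in> bounded_ops"
  shows "adj_op (T o\<^sub>L R) = adj_op R o\<^sub>L (adj_op T :: 'h \<Rightarrow>\<^sub>L 'h)"
  using assms by (intro adj_op_eqI)
    (simp_all add: bounded_ops_compose adj_op_bounded_ops cinner_adj_op_left)

lemma adj_op_scaleC:
  assumes "T \<in> bounded_ops"
  shows "adj_op (scaleC_op c T) = scaleC_op (cnj c) (adj_op T :: 'h \<Rightarrow>\<^sub>L 'h)"
  using assms by (intro adj_op_eqI)
    (simp_all add: bounded_ops_scaleC adj_op_bounded_ops scaleC_op_apply cinner_scaleC_left cinner_scaleC_right cinner_adj_op_left)

end

lemma adj_op_id: "adj_op id_blinfun = id_blinfun"
  by (rule adj_op_eqI) (simp_all add: bounded_ops_id)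

lemma adj_op_hermitian: "hermitian T \<Longrightarrow> adj_op T = T"
  by (rule adj_op_eqI) (simp_all add: hermitian_def)

section \<open>Characters\<close>

lemma
  fixes A :: "('h::complex_hilbert \<Rightarrow>\<^sub>L 'h) set"
  defines "M \<equiv> unital_cstar_subalgebra hull A"
  shows closed_cstar_hull: "closed M"
    and cstar_hull_id: "id_blinfun \<in> M"
    and cstar_hull_add: "T \<in> M \<Longrightarrow> R \<in> M \<Longrightarrow> T + R \<in> M"
    and cstar_hull_compose: "T \<in> M \<Longrightarrow> R \<in> M \<Longrightarrow> T o\<^sub>L R \<in> M"
    and cstar_hull_scaleC: "T \<in> M \<Longrightarrow> scaleC_op c T \<in> M"
  unfolding M_def hull_def by (auto simp: unital_cstar_subalgebra_def intro!: closed_Inter)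

lemma character_on_subset: "character_on N \<phi> \<Longrightarrow> M \<subseteq> N \<Longrightarrow> character_on M \<phi>"
  unfolding character_on_def by blast

text \<open>If \<open>\<phi> R\<close> exceeded the norm of \<open>R\<close>, then after scaling \<open>\<phi> R = 1\<close> and \<open>\<parallel>R\<parallel> < 1\<close>; applying \<open>\<phi>\<close> to
  the solution of \<open>Q = R + R Q\<close> would give \<open>0 = 1\<close>.\<close>

lemma character_le_norm:
  fixes A :: "('h::complex_hilbert \<Rightarrow>\<^sub>L 'h) set"
  assumes \<phi>: "character_on (unital_cstar_subalgebra hull A) \<phi>"
    and R: "R \<in> unital_cstar_subalgebra hull A"
  shows "cmod (\<phi> R) \<le> norm R"
proof (rule ccontr)
  let ?M = "unital_cstar_subalgebra hull A"
  assume "\<not> ?thesis"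
  then have less: "norm R < cmod (\<phi> R)"
    by simp
  then have pos: "cmod (\<phi> R) > 0"
    using norm_ge_zero le_less_trans by blast
  define R' where "R' = scaleC_op (inverse (\<phi> R)) R"
  have R': "R' \<in> ?M"
    unfolding R'_def by (rule cstar_hull_scaleC[OF R])
  have \<phi>R': "\<phi> R' = 1"
    using \<phi> R pos by (simp add: character_on_def R'_def)
  have "norm R' \<le> inverse (cmod (\<phi> R)) * norm R"
    unfolding R'_def using norm_scaleC_op[of "inverse (\<phi> R)" R] by (simp add: norm_inverse)
  also have "\<dots> < 1"
    using less pos by (simp add: field_simps)
  finally have "norm R' < 1" .
  moreover have "dist (R' + (R' o\<^sub>L P)) (R' + (R' o\<^sub>L Q)) \<le> norm R' * dist P Q" for P Q
  proof -
    have "(R' o\<^sub>L P) - (R' o\<^sub>L Q) = R' o\<^sub>L (P - Q)"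
      by (rule blinfun_eqI) (simp add: blinfun.diff_left blinfun.diff_right)
    then show ?thesis
      using norm_blinfun_compose[of R' "P - Q"] by (simp add: dist_norm)
  qed
  \<comment> \<open>The contraction acts on the closed set \<open>?M\<close>, so its fixed point
    lies in the algebra, where \<open>\<phi>\<close> is known to be multiplicative.\<close>
  ultimately have "\<exists>!Q\<in>?M. R' + (R' o\<^sub>L Q) = Q"
    using R' cstar_hull_id[of A] closed_cstar_hull[of A]
    by (intro Banach_fix[where c = "norm R'"])
      (auto simp: complete_eq_closed intro: cstar_hull_add cstar_hull_compose)
  then obtain Q where Q: "Q \<in> ?M" "R' + (R' o\<^sub>L Q) = Q"
    by blast
  have "\<phi> (R' + (R' o\<^sub>L Q)) = \<phi> R' + \<phi> R' * \<phi> Q"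
    using \<phi> R' Q(1) cstar_hull_compose[OF R' Q(1)] by (simp add: character_on_def)
  then show False
    by (simp add: Q(2) \<phi>R')
qed

text \<open>Turns an affine functional of the point \<open>\<mu>\<close> into the value of the
  character at one operator, so that a separating hyperplane can be confronted with the norm bound
  for characters.\<close>

lemma character_linear_combination:
  fixes A :: "('h::complex_hilbert \<Rightarrow>\<^sub>L 'h) ^ 'n" and a :: "real ^ 'n" and K :: real
  assumes \<phi>: "character_on (unital_cstar_subalgebra hull range (($) A)) \<phi>"
    and \<mu>: "\<And>i. \<phi> (A $ i) = complex_of_real (\<mu> $ i)"
  defines "T \<equiv> (\<Sum>i\<in>UNIV. scaleC_op (complex_of_real (a $ i)) (A $ i)) + scaleC_op (complex_of_real K) id_blinfun"
  shows "T \<in> unital_cstar_subalgebra hull range (($) A)"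
    and "\<phi> T = complex_of_real (inner a \<mu> + K)"
proof -
  let ?M = "unital_cstar_subalgebra hull range (($) A)"
  let ?f = "\<lambda>i. scaleC_op (complex_of_real (a $ i)) (A $ i)"
  have A: "A $ i \<in> ?M" for i
    by (rule hull_inc) simp
  have 0: "scaleC_op 0 id_blinfun = (0 :: 'h \<Rightarrow>\<^sub>L 'h)"
    by (rule blinfun_eqI) (simp add: scaleC_op_apply)
  have id: "scaleC_op c id_blinfun \<in> ?M" "\<phi> (scaleC_op c id_blinfun) = c" for c
    using \<phi> cstar_hull_id[of "range (($) A)"] cstar_hull_scaleC[OF cstar_hull_id, of c "range (($) A)"]
    by (simp_all add: character_on_def)
  have f: "?f i \<in> ?M" "\<phi> (?f i) = complex_of_real (a $ i * \<mu> $ i)" for i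
    using \<phi> A cstar_hull_scaleC[OF A] \<mu> by (simp_all add: character_on_def)
  \<comment> \<open>Membership is carried along in the induction because \<open>\<phi>\<close> is
    additive only on \<open>?M\<close>.\<close>
  have "sum ?f F \<in> ?M \<and> \<phi> (sum ?f F) = complex_of_real (\<Sum>i\<in>F. a $ i * \<mu> $ i)" if "finite F" for F
    using that
  proof induction
    case empty
    show ?case
      using id[of 0] by (simp add: 0)
  next
    case (insert i F)
    then show ?case
      using \<phi> f[of i] cstar_hull_add[of "?f i" _ "sum ?f F"] by (simp add: character_on_def)
  qed
  from this[OF finite_class.finite_UNIV] show "T \<in> ?M" "\<phi> T = complex_of_real (inner a \<mu> + K)"
    using \<phi> id[of "complex_of_real K"] cstar_hull_add[OF _ id(1)] unfolding T_def
    by (simp_all add: character_on_def inner_vec_def)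
qed

section \<open>Diagonal operators\<close>

lemma diagonal_operator:
  fixes B :: "'h::complex_hilbert set"
  assumes B: "orthonormal_basis B" and K: "K \<ge> 0" "\<And>b. b \<in> B \<Longrightarrow> cmod (d b) \<le> K"
  obtains D where "D \<in> bounded_ops" "norm D \<le> K"
    "\<And>x. D x = (\<Sum>\<^sub>\<infinity>b\<in>B. (d b * cinner b x) *\<^sub>C b)" "\<And>b. b \<in> B \<Longrightarrow> D b = d b *\<^sub>C b"
proof -
  note on = orthonormal_basis_orthonormal_on[OF B]
  \<comment> \<open>The conjugate compensates for the conjugate-linear first argument of
    \<open>cinner\<close>, so that the diagonal entry becomes \<open>d b\<close>.\<close>
  have bdd: "(\<Sum>b\<in>F. (cmod (cinner (cnj (d b) *\<^sub>C b) x))\<^sup>2) \<le> (K * norm x)\<^sup>2"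
    if F: "finite F" "F \<subseteq> B" for F x
  proof -
    have "(\<Sum>b\<in>F. (cmod (cinner (cnj (d b) *\<^sub>C b) x))\<^sup>2) \<le> (\<Sum>b\<in>F. K\<^sup>2 * (cmod (cinner b x))\<^sup>2)"
      using F(2) K by (intro sum_mono)
        (auto simp: cinner_scaleC_left norm_mult power_mult_distrib intro!: mult_right_mono power_mono)
    also have "\<dots> \<le> K\<^sup>2 * (norm x)\<^sup>2"
      unfolding sum_distrib_left[symmetric] by (intro mult_left_mono bessel_inequality[OF on F]) simp
    finally show ?thesis
      by (simp add: power_mult_distrib)
  qed
  from synthesis_operator[OF on K(1) bdd]
  obtain D :: "'h \<Rightarrow>\<^sub>L 'h" where D: "D \<in> bounded_ops" "norm D \<le> K"
    "\<forall>x. D x = (\<Sum>\<^sub>\<infinity>b\<in>B. cinner (cnj (d b) *\<^sub>C b) x *\<^sub>C b)"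
    "\<forall>b\<in>B. \<forall>x. cinner b (D x) = cinner (cnj (d b) *\<^sub>C b) x"
    by blast
  show thesis
  proof (rule that[OF D(1,2)])
    show "D x = (\<Sum>\<^sub>\<infinity>b\<in>B. (d b * cinner b x) *\<^sub>C b)" for x
      by (simp add: D(3) cinner_scaleC_left)
    show "D b = d b *\<^sub>C b" if "b \<in> B" for b
    proof (rule orthonormal_basis_cinner_eqI[OF B])
      show "cinner b' (D b) = cinner b' (d b *\<^sub>C b)" if "b' \<in> B" for b'
        using that \<open>b \<in> B\<close> orthonormal_onD[OF on that \<open>b \<in> B\<close>]
        by (simp add: D(4) cinner_scaleC_left cinner_scaleC_right)
    qed
  qed
qed

text \<open>Agreement on a total set identifies \<open>T\<close> with the diagonal operator just
  built. This converts entrywise estimates into operator norm estimates, in the separation argument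
  for diagonal tuples and in the final approximation.\<close>

lemma norm_diagonal_le:
  fixes T :: "'h::complex_hilbert \<Rightarrow>\<^sub>L 'h"
  assumes B: "orthonormal_basis B" and K: "K \<ge> 0" "\<And>b. b \<in> B \<Longrightarrow> cmod (d b) \<le> K"
    and T: "T \<in> bounded_ops" "\<And>b. b \<in> B \<Longrightarrow> T b = d b *\<^sub>C b"
  shows "norm T \<le> K"
proof (rule diagonal_operator[OF B K])
  fix D
  assume D: "D \<in> bounded_ops" "norm D \<le> K" "\<And>b. b \<in> B \<Longrightarrow> D b = d b *\<^sub>C b"
  have "T = D"
    using T D by (intro bounded_ops_eqI[OF orthonormal_basis_total[OF B]]) simp_all
  with D show ?thesis
    by simp
qed

lemma orthonormal_basis_norm: "orthonormal_basis B \<Longrightarrow> b \<in> B \<Longrightarrow> norm b = 1"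
  using orthonormal_on_norm[OF orthonormal_basis_orthonormal_on] .

lemma orthonormal_basis_cinner:
  "orthonormal_basis B \<Longrightarrow> b \<in> B \<Longrightarrow> b' \<in> B \<Longrightarrow> cinner b b' = (if b = b' then 1 else 0)"
  by (simp add: orthonormal_basis_def)

lemma cmod_cinner_apply_le:
  fixes T :: "'h::complex_hilbert \<Rightarrow>\<^sub>L 'h"
  assumes "norm x = 1"
  shows "cmod (cinner x (T x)) \<le> norm T"
  using cmod_cinner_le[of x "T x"] norm_blinfun[of T x] assms by simp

lemma
  fixes B :: "'h::complex_hilbert set"
  assumes B: "orthonormal_basis B" and T: "T \<in> bounded_ops"
  shows diag_compression_bounded_ops: "diag_compression B T \<in> bounded_ops"
    and diag_compression_basis: "b \<in> B \<Longrightarrow> diag_compression B T b = cinner b (T b) *\<^sub>C b"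
proof -
  have le: "cmod (cinner b (T b)) \<le> norm T" if "b \<in> B" for b
    using cmod_cinner_apply_le orthonormal_basis_norm[OF B that] .
  have "diag_compression B T \<in> bounded_ops \<and> (\<forall>b\<in>B. diag_compression B T b = cinner b (T b) *\<^sub>C b)"
  proof (rule diagonal_operator[OF B norm_ge_zero le])
    fix D
    assume D: "D \<in> bounded_ops" "\<And>x. D x = (\<Sum>\<^sub>\<infinity>b\<in>B. (cinner b (T b) * cinner b x) *\<^sub>C b)"
      "\<And>b. b \<in> B \<Longrightarrow> D b = cinner b (T b) *\<^sub>C b"
    \<comment> \<open>\<open>D\<close> is a bounded operator with the same series, so
      \<open>Blinfun\<close> in the definition of the compression has its intended value.\<close>
    have "diag_compression B T = D"
      by (simp add: diag_compression_def D(2)[symmetric] blinfun_apply_inverse)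
    with D show ?thesis
      by simp
  qed
  then show "diag_compression B T \<in> bounded_ops"
    "b \<in> B \<Longrightarrow> diag_compression B T b = cinner b (T b) *\<^sub>C b"
    by simp_all
qed

lemma atomic_masa_basis:
  fixes T :: "'h::complex_hilbert \<Rightarrow>\<^sub>L 'h"
  assumes "orthonormal_basis B" "T \<in> atomic_masa B" "b \<in> B"
  shows "T b = cinner b (T b) *\<^sub>C b"
proof -
  obtain c where "T b = c *\<^sub>C b"
    using assms(2,3) by (auto simp: atomic_masa_def)
  then show ?thesis
    using orthonormal_basis_cinner[OF assms(1,3,3)] by (simp add: cinner_scaleC_right)
qed

text \<open>With the eigenvalue written as the diagonal entry, membership becomes an equation
  between continuous functions of \<open>T\<close>; closedness of the algebra is read off from this
  form.\<close>

lemma atomic_masa_iff: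
  fixes T :: "'h::complex_hilbert \<Rightarrow>\<^sub>L 'h"
  assumes "orthonormal_basis B"
  shows "T \<in> atomic_masa B \<longleftrightarrow> T \<in> bounded_ops \<and> (\<forall>b\<in>B. T b = cinner b (T b) *\<^sub>C b)"
  using atomic_masa_basis[OF assms, of T] by (auto simp: atomic_masa_def)

lemma unital_cstar_subalgebra_atomic_masa:
  fixes B :: "'h::complex_hilbert set"
  assumes B: "orthonormal_basis B"
  shows "unital_cstar_subalgebra (atomic_masa B)"
  unfolding unital_cstar_subalgebra_def
proof (intro conjI ballI allI)
  show "atomic_masa B \<subseteq> bounded_ops"
    by (auto simp: atomic_masa_def)
  have "atomic_masa B = bounded_ops \<inter> (\<Inter>b\<in>B. {T :: 'h \<Rightarrow>\<^sub>L 'h. T b = cinner b (T b) *\<^sub>C b})"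
    using atomic_masa_iff[OF B] by auto
  then show "closed (atomic_masa B)"
    by (simp only:) (intro closed_Int closed_bounded_ops closed_INT ballI closed_Collect_eq
        continuous_intros scaleC.continuous_on cinner.continuous_on)
  show "id_blinfun \<in> atomic_masa B"
    by (auto simp: atomic_masa_def bounded_ops_id intro!: exI[of _ 1] simp: scaleC_one)
next
  fix T R :: "'h \<Rightarrow>\<^sub>L 'h"
  assume T: "T \<in> atomic_masa B" and R: "R \<in> atomic_masa B"
  have T': "T \<in> bounded_ops" and R': "R \<in> bounded_ops"
    using T R by (auto simp: atomic_masa_def)
  have "\<exists>c. (T + R) b = c *\<^sub>C b \<and> (\<exists>c. (T o\<^sub>L R) b = c *\<^sub>C b)" if b: "b \<in> B" for b
  proof -
    obtain c d where "T b = c *\<^sub>C b" "R b = d *\<^sub>C b"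
      using T R b unfolding atomic_masa_def by blast
    then have "(T + R) b = (c + d) *\<^sub>C b" "(T o\<^sub>L R) b = (d * c) *\<^sub>C b"
      by (simp_all add: blinfun.add_left scaleC_add_left bounded_opsD[OF T'] scaleC_scaleC)
    then show ?thesis
      by blast
  qed
  then show "T + R \<in> atomic_masa B" "T o\<^sub>L R \<in> atomic_masa B"
    by (simp_all add: atomic_masa_def bounded_ops_add[OF T' R'] bounded_ops_compose[OF T' R'] del: blinfun_apply_blinfun_compose)
next
  fix T :: "'h \<Rightarrow>\<^sub>L 'h" and c :: complex
  assume T: "T \<in> atomic_masa B"
  then have T': "T \<in> bounded_ops"
    by (auto simp: atomic_masa_def)
  show "scaleC_op c T \<in> atomic_masa B"
    using T unfolding atomic_masa_def by (force simp: bounded_ops_scaleC scaleC_op_apply scaleC_scaleC)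
  show "adj_op T \<in> atomic_masa B"
    unfolding atomic_masa_iff[OF B]
  proof (intro conjI ballI adj_op_bounded_ops[OF B T'])
    fix b assume b: "b \<in> B"
    show "adj_op T b = cinner b (adj_op T b) *\<^sub>C b"
    proof (rule orthonormal_basis_cinner_eqI[OF B])
      fix b' assume b': "b' \<in> B"
      have "cinner b' (adj_op T b) = cinner (T b') b"
        by (rule cinner_adj_op_right[OF B T'])
      also have "\<dots> = cnj (cinner b' (T b')) * cinner b' b"
        by (subst atomic_masa_basis[OF B T b']) (simp add: cinner_scaleC_left)
      finally show "cinner b' (adj_op T b) = cinner b' (cinner b (adj_op T b) *\<^sub>C b)"
        using orthonormal_basis_cinner[OF B b' b] by (auto simp: cinner_scaleC_right)
    qed
  qed
qed

section \<open>Joint spectra of diagonal tuples\<close>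

lemma cinner_hermitian_real:
  fixes T :: "'h::complex_hilbert \<Rightarrow>\<^sub>L 'h"
  assumes "hermitian T"
  shows "cinner x (T x) = complex_of_real (Re (cinner x (T x)))"
proof -
  have "cnj (cinner x (T x)) = cinner x (T x)"
    using assms cinner_commute[of x "T x"] by (simp add: hermitian_def)
  then show ?thesis
    by (simp add: complex_eq_iff)
qed

text \<open>A vector state is multiplicative on any algebra for which its vector is a common
  eigenvector. Hence \<open>b\<close> gives a character of the whole diagonal algebra, which
  restricts to the algebra generated by \<open>A\<close>.\<close>

lemma diagonal_in_joint_spectrum:
  fixes A :: "('h::complex_hilbert \<Rightarrow>\<^sub>L 'h) ^ 'n"
  assumes B: "orthonormal_basis B" and b: "b \<in> B"
    and A: "\<And>i. A $ i \<in> atomic_masa B" "\<And>i. hermitian (A $ i)"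
  shows "(\<chi> i. Re (cinner b ((A $ i) b))) \<in> joint_spectrum A"
proof -
  have "character_on (atomic_masa B) (\<lambda>T. cinner b (T b))"
    unfolding character_on_def
  proof (intro conjI ballI allI)
    show "cinner b (id_blinfun b) = 1"
      using orthonormal_basis_cinner[OF B b b] by simp
    fix T R assume T: "T \<in> atomic_masa B" and R: "R \<in> atomic_masa B"
    show "cinner b ((T + R) b) = cinner b (T b) + cinner b (R b)"
      by (simp add: blinfun.add_left cinner_add_right)
    have "T (R b) = cinner b (R b) *\<^sub>C T b"
      using T by (subst atomic_masa_basis[OF B R b]) (simp add: bounded_opsD atomic_masa_def)
    then show "cinner b ((T o\<^sub>L R) b) = cinner b (T b) * cinner b (R b)"
      by (simp add: cinner_scaleC_right)
  qed (simp add: scaleC_op_apply cinner_scaleC_right)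
  moreover have "unital_cstar_subalgebra hull range (($) A) \<subseteq> atomic_masa B"
    using A by (intro hull_minimal unital_cstar_subalgebra_atomic_masa[OF B]) auto
  ultimately have "character_on (unital_cstar_subalgebra hull range (($) A)) (\<lambda>T. cinner b (T b))"
    by (rule character_on_subset)
  then show ?thesis
    using cinner_hermitian_real[OF A(2)] unfolding joint_spectrum_def by auto
qed

text \<open>If \<open>a\<close> separated a spectral point \<open>\<mu>\<close> from
  \<open>C\<close>, then \<open>K\<close> minus the combination of the \<open>A $ i\<close> with
  coefficients \<open>a $ i\<close> would be diagonal with entries between 0 and
  \<open>K - \<beta>\<close>, hence of norm at most \<open>K - \<beta>\<close>, although the
  character takes the larger value \<open>K - inner a \<mu>\<close> on it.\<close>

lemma joint_spectrum_subset_convex: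
  fixes A :: "('h::complex_hilbert \<Rightarrow>\<^sub>L 'h) ^ 'n"
  assumes B: "orthonormal_basis B"
    and A: "\<And>i. A $ i \<in> atomic_masa B" "\<And>i. hermitian (A $ i)"
    and C: "closed C" "convex C" "\<And>b. b \<in> B \<Longrightarrow> (\<chi> i. Re (cinner b ((A $ i) b))) \<in> C"
  shows "joint_spectrum A \<subseteq> C"
proof (rule ccontr)
  assume "\<not> ?thesis"
  then obtain \<mu> \<phi> where \<mu>: "\<mu> \<notin> C" and \<phi>: "character_on (unital_cstar_subalgebra hull range (($) A)) \<phi>"
    and \<phi>\<mu>: "\<And>i. \<phi> (A $ i) = complex_of_real (\<mu> $ i)"
    by (auto simp: joint_spectrum_def)
  obtain a \<beta> where a: "inner a \<mu> < \<beta>" "\<And>x. x \<in> C \<Longrightarrow> \<beta> < inner a x"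
    using separating_hyperplane_closed_point[OF C(2,1) \<mu>] by blast
  define W where "W = (\<Sum>i\<in>UNIV. \<bar>a $ i\<bar> * norm (A $ i))"
  \<comment> \<open>\<open>W\<close> dominates \<open>inner a\<close> at every diagonal value, so
    this shift makes all entries nonnegative and a one-sided bound suffices;
    \<open>\<bar>\<beta>\<bar>\<close> ensures \<open>0 \<le> K - \<beta>\<close>.\<close>
  define K where "K = W + \<bar>\<beta>\<bar>"
  let ?T = "(\<Sum>i\<in>UNIV. scaleC_op (complex_of_real ((- a) $ i)) (A $ i)) + scaleC_op (complex_of_real K) id_blinfun"
  let ?x = "\<lambda>b. \<chi> i. Re (cinner b ((A $ i) b))"
  have "W \<ge> 0"
    unfolding W_def by (intro sum_nonneg) simp
  have T: "?T \<in> unital_cstar_subalgebra hull range (($) A)" "\<phi> ?T = complex_of_real (inner (- a) \<mu> + K)"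
    using character_linear_combination[OF \<phi> \<phi>\<mu>] by blast+
  have "unital_cstar_subalgebra hull range (($) A) \<subseteq> atomic_masa B"
    using A by (intro hull_minimal unital_cstar_subalgebra_atomic_masa[OF B]) auto
  then have T': "?T \<in> bounded_ops"
    using T(1) by (auto simp: atomic_masa_def)
  have Tb: "?T b = complex_of_real (K - inner a (?x b)) *\<^sub>C b" if b: "b \<in> B" for b
  proof -
    have "(A $ i) b = complex_of_real (?x b $ i) *\<^sub>C b" for i
      using atomic_masa_basis[OF B A(1) b] cinner_hermitian_real[OF A(2), of b i] by simp
    then have "?T b = (\<Sum>i\<in>UNIV. complex_of_real (- (a $ i)) *\<^sub>C complex_of_real (?x b $ i) *\<^sub>C b) + complex_of_real K *\<^sub>C b"
      by (simp add: blinfun.add_left blinfun.sum_left scaleC_op_apply)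
    also have "\<dots> = (\<Sum>i\<in>UNIV. complex_of_real (- (a $ i) * ?x b $ i)) *\<^sub>C b + complex_of_real K *\<^sub>C b"
      unfolding scaleC.sum_left by (simp add: scaleC_scaleC)
    also have "\<dots> = complex_of_real (K - inner a (?x b)) *\<^sub>C b"
      by (simp add: inner_vec_def sum_negf scaleC.diff_left)
    finally show ?thesis .
  qed
  have "norm ?T \<le> K - \<beta>"
  proof (rule norm_diagonal_le[OF B _ _ T' Tb])
    show "0 \<le> K - \<beta>"
      using \<open>W \<ge> 0\<close> by (simp add: K_def)
    fix b assume b: "b \<in> B"
    have "inner a (?x b) \<le> W"
      unfolding inner_vec_def W_def
    proof (rule sum_mono)
      fix i
      have "\<bar>Re (cinner b ((A $ i) b))\<bar> \<le> norm (A $ i)"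
        using abs_Re_le_cmod[of "cinner b ((A $ i) b)"]
          cmod_cinner_apply_le[OF orthonormal_basis_norm[OF B b], of "A $ i"] by linarith
      then have "\<bar>a $ i * ?x b $ i\<bar> \<le> \<bar>a $ i\<bar> * norm (A $ i)"
        by (simp add: abs_mult mult_left_mono)
      then show "inner (a $ i) (?x b $ i) \<le> \<bar>a $ i\<bar> * norm (A $ i)"
        by simp
    qed
    then have "\<bar>K - inner a (?x b)\<bar> \<le> K - \<beta>"
      using a(2)[OF C(3)[OF b]] \<open>W \<ge> 0\<close> unfolding K_def by linarith
    then show "cmod (complex_of_real (K - inner a (?x b))) \<le> K - \<beta>"
      by (simp only: norm_of_real)
  qed
  moreover have "cmod (\<phi> ?T) \<le> norm ?T"
    by (rule character_le_norm[OF \<phi> T(1)])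
  ultimately show False
    using a(1) unfolding T(2) norm_of_real by simp
qed

section \<open>Joint approximate eigenvectors\<close>

text \<open>The constraints are a set of pairs of an operator and its intended eigenvalue, so that
  the operators of a tuple can be added one at a time with a common tolerance.\<close>

definition approx_eigenvector ::
    "(('h::real_inner \<Rightarrow>\<^sub>L 'h) \<times> real) set \<Rightarrow> real \<Rightarrow> 'h \<Rightarrow> bool" where
  "approx_eigenvector L e x \<longleftrightarrow> norm x = 1 \<and> (\<forall>(R, r)\<in>L. norm (blinfun_apply R x - r *\<^sub>R x) < e)"

lemma approx_eigenvector_insert:
  "approx_eigenvector (insert (P, m) L) e x \<longleftrightarrow>
    approx_eigenvector L e x \<and> norm (blinfun_apply P x - m *\<^sub>R x) < e"
  by (auto simp: approx_eigenvector_def)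

lemma approx_eigenvector_mono: "approx_eigenvector L e x \<Longrightarrow> e \<le> e' \<Longrightarrow> approx_eigenvector L e' x"
  by (fastforce simp: approx_eigenvector_def)

text \<open>The new approximate eigenvalue \<open>m\<close> is the largest asymptotic value of \<open>\<parallel>P x\<parallel>\<close> on approximate
  eigenvectors \<open>x\<close> of \<open>L\<close>. As \<open>P x / \<parallel>P x\<parallel>\<close> is again such a vector, \<open>\<parallel>P\<^sup>2 x\<parallel>\<close> is at most about
  \<open>m\<^sup>2\<close> when \<open>\<parallel>P x\<parallel>\<close> is close to \<open>m\<close>, which forces \<open>P\<^sup>2 x\<close> to be close to \<open>m\<^sup>2 x\<close>.\<close>

lemma approx_eigenvector_extend:
  fixes P :: "'h::real_inner \<Rightarrow>\<^sub>L 'h" and L :: "(('h \<Rightarrow>\<^sub>L 'h) \<times> real) set"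
  assumes sym: "\<And>x y. inner (P x) y = inner x (P y)" and pos: "\<And>x. 0 \<le> inner x (P x)"
    and comm: "\<forall>(R, r)\<in>L. \<forall>x. P (blinfun_apply R x) = blinfun_apply R (P x)"
    and L: "\<forall>e>0. \<exists>x. approx_eigenvector L e x"
  shows "\<exists>m. (\<forall>e>0. \<exists>x. approx_eigenvector (insert (P, m) L) e x) \<and>
    (\<forall>\<nu>. (\<forall>e>0. \<exists>x. approx_eigenvector L e x \<and> \<nu> \<le> norm (P x)) \<longrightarrow> \<nu> \<le> m)"
proof -
  define V where "V = {\<nu>. \<forall>e>0. \<exists>x. approx_eigenvector L e x \<and> \<nu> \<le> norm (P x)}"
  define m where "m = Sup V"
  have "0 \<in> V"
    using L by (auto simp: V_def)
  have "bdd_above V"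
  proof (rule bdd_aboveI)
    fix \<nu> assume "\<nu> \<in> V"
    then obtain x where "approx_eigenvector L 1 x" "\<nu> \<le> norm (P x)"
      unfolding V_def using zero_less_one by blast
    then show "\<nu> \<le> norm P"
      using norm_blinfun[of P x] by (simp add: approx_eigenvector_def)
  qed
  then have upper: "\<nu> \<le> m" if "\<nu> \<in> V" for \<nu>
    unfolding m_def using that by (intro cSup_upper)
  have "m \<ge> 0"
    by (rule upper) fact
  have above: "\<exists>e0>0. \<forall>x. approx_eigenvector L e0 x \<longrightarrow> norm (P x) < m + \<eta>" if "\<eta> > 0" for \<eta>
    using upper[of "m + \<eta>"] that unfolding V_def by (force simp: not_le)
  have main: "\<exists>x. approx_eigenvector L e x \<and> norm (P x - m *\<^sub>R x) < e" if e: "e > 0" for e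
  proof (cases "m = 0")
    case True
    obtain e0 where e0: "e0 > 0" "\<And>x. approx_eigenvector L e0 x \<Longrightarrow> norm (P x) < m + e"
      using above[OF e] by blast
    obtain x where "approx_eigenvector L (min e e0) x"
      using L e e0(1) by (metis min_less_iff_conj)
    then have "approx_eigenvector L e x" "approx_eigenvector L e0 x"
      by (auto elim: approx_eigenvector_mono)
    with e0(2)[of x] True show ?thesis
      by auto
  next
    case False
    with \<open>m \<ge> 0\<close> have m: "m > 0"
      by simp
    \<comment> \<open>This is the upper bound for the squared norm of
      \<open>P (P x) - m\<^sup>2 *\<^sub>R x\<close> obtained below from
      \<open>norm (P (P x)) \<le> (m + \<eta>)\<^sup>2\<close> and
      \<open>m - \<eta> \<le> norm (P x)\<close>; at 0 its three terms cancel.\<close>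
    have "((\<lambda>\<eta>. ((m + \<eta>)\<^sup>2)\<^sup>2 - 2 * m\<^sup>2 * (m - \<eta>)\<^sup>2 + (m\<^sup>2)\<^sup>2) \<longlongrightarrow> 0) (at_right 0)"
      by (auto intro!: tendsto_eq_intros simp: power2_eq_square)
    then have "eventually (\<lambda>\<eta>. ((m + \<eta>)\<^sup>2)\<^sup>2 - 2 * m\<^sup>2 * (m - \<eta>)\<^sup>2 + (m\<^sup>2)\<^sup>2 < (m * e)\<^sup>2) (at_right 0)"
      using m e by (intro order_tendstoD) auto
    moreover have "eventually (\<lambda>\<eta>. \<eta> \<in> {0<..<m}) (at_right 0)"
      using m by (rule eventually_at_right_real)
    ultimately have "eventually (\<lambda>\<eta>. \<eta> \<in> {0<..<m} \<and>
        ((m + \<eta>)\<^sup>2)\<^sup>2 - 2 * m\<^sup>2 * (m - \<eta>)\<^sup>2 + (m\<^sup>2)\<^sup>2 < (m * e)\<^sup>2) (at_right 0)"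
      by eventually_elim simp
    then obtain \<eta> where \<eta>: "0 < \<eta>" "\<eta> < m"
      "((m + \<eta>)\<^sup>2)\<^sup>2 - 2 * m\<^sup>2 * (m - \<eta>)\<^sup>2 + (m\<^sup>2)\<^sup>2 < (m * e)\<^sup>2"
      using eventually_happens'[of "at_right (0::real)"] by auto
    obtain e0 where e0: "e0 > 0" "\<And>x. approx_eigenvector L e0 x \<Longrightarrow> norm (P x) < m + \<eta>"
      using above[OF \<eta>(1)] by blast
    obtain \<nu> where \<nu>: "\<nu> \<in> V" "m - \<eta> < \<nu>"
      using less_cSupD[of V "m - \<eta>"] \<open>0 \<in> V\<close> \<eta>(1) unfolding m_def by auto
    \<comment> \<open>The last bound makes \<open>P x / norm (P x)\<close> an approximate
      eigenvector of \<open>L\<close> with tolerance \<open>e0\<close>: applying \<open>P\<close>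
      enlarges the error by at most \<open>norm P\<close> and normalising divides it by more than
      \<open>m - \<eta>\<close>. The 1 keeps the denominator positive.\<close>
    define e1 where "e1 = min e (min e0 (e0 * (m - \<eta>) / (norm P + 1)))"
    have nP: "norm P + 1 > 0"
      using norm_ge_zero[of P] by linarith
    have e1: "e1 > 0" "e1 \<le> e" "e1 \<le> e0" "e1 \<le> e0 * (m - \<eta>) / (norm P + 1)"
      using e e0(1) \<eta> nP unfolding e1_def by auto
    have "norm P * e1 \<le> (norm P + 1) * e1"
      using e1(1) by (intro mult_right_mono) auto
    also have "\<dots> \<le> e0 * (m - \<eta>)"
      using e1(4) nP by (simp add: pos_le_divide_eq mult.commute)
    finally have Pe1: "norm P * e1 \<le> e0 * (m - \<eta>)" .
    obtain x where x: "approx_eigenvector L e1 x" "\<nu> \<le> norm (P x)"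
      using \<nu>(1) e1(1) unfolding V_def by blast
    define n where "n = norm (P x)"
    have n: "m - \<eta> < n" "n > 0"
      using x(2) \<nu>(2) \<eta>(2) by (auto simp: n_def)
    have "n < m + \<eta>"
      unfolding n_def by (rule e0(2)[OF approx_eigenvector_mono[OF x(1) e1(3)]])
    define v where "v = (1 / n) *\<^sub>R P x"
    have "norm (R v - r *\<^sub>R v) < e0" if Rr: "(R, r) \<in> L" for R r
    proof -
      have PR: "P (R x) = R (P x)" for x
        using comm Rr by auto
      have "n * norm (R v - r *\<^sub>R v) = norm (n *\<^sub>R (R v - r *\<^sub>R v))"
        using n(2) by simp
      also have "n *\<^sub>R (R v - r *\<^sub>R v) = P (R x - r *\<^sub>R x)"
        using n(2) by (simp add: v_def blinfun.scaleR_right blinfun.diff_right PR scaleR_diff_right)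
      also have "norm \<dots> \<le> norm P * norm (R x - r *\<^sub>R x)"
        by (rule norm_blinfun)
      also have "\<dots> \<le> norm P * e1"
        using x(1) Rr by (intro mult_left_mono) (auto simp: approx_eigenvector_def less_imp_le)
      also have "\<dots> \<le> e0 * (m - \<eta>)"
        by (rule Pe1)
      also have "\<dots> < n * e0"
        using n(1) e0(1) by (simp add: mult.commute)
      finally show ?thesis
        using n(2) by simp
    qed
    then have "approx_eigenvector L e0 v"
      using n(2) by (auto simp: approx_eigenvector_def v_def n_def)
    from e0(2)[OF this] have "norm (P (P x)) < (m + \<eta>) * n"
      using n(2) by (simp add: v_def blinfun.scaleR_right field_simps)
    also have "\<dots> \<le> (m + \<eta>)\<^sup>2"
      using \<open>n < m + \<eta>\<close> m \<eta>(1) by (simp add: power2_eq_square)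
    finally have "(norm (P (P x)))\<^sup>2 \<le> ((m + \<eta>)\<^sup>2)\<^sup>2"
      by (intro power_mono) simp_all
    moreover have "(m - \<eta>)\<^sup>2 \<le> n\<^sup>2"
      using n(1) \<eta>(2) by (intro power_mono) simp_all
    then have "2 * m\<^sup>2 * (m - \<eta>)\<^sup>2 \<le> 2 * m\<^sup>2 * n\<^sup>2"
      by (rule mult_left_mono) simp
    moreover have "(norm (P (P x) - m\<^sup>2 *\<^sub>R x))\<^sup>2 = (norm (P (P x)))\<^sup>2 - 2 * m\<^sup>2 * n\<^sup>2 + (m\<^sup>2)\<^sup>2"
    proof -
      have "inner x x = 1"
        using x(1) by (simp add: approx_eigenvector_def power2_norm_eq_inner[symmetric])
      moreover have "inner (P (P x)) x = n\<^sup>2"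
        unfolding n_def power2_norm_eq_inner by (rule sym)
      moreover have "inner (y - c *\<^sub>R x) (y - c *\<^sub>R x) = inner y y - 2 * c * inner y x + c\<^sup>2 * inner x x" for y c
        by (simp only: inner_diff_left inner_diff_right inner_scaleR_left inner_scaleR_right inner_commute[of x y])
          (simp add: algebra_simps power2_eq_square)
      ultimately show ?thesis
        by (simp only: power2_norm_eq_inner mult_1_right)
    qed
    ultimately have "(norm (P (P x) - m\<^sup>2 *\<^sub>R x))\<^sup>2 < (m * e)\<^sup>2"
      using \<eta>(3) by linarith
    then have less: "norm (P (P x) - m\<^sup>2 *\<^sub>R x) < m * e"
      by (rule power2_less_imp_less) (use m e in simp)
    \<comment> \<open>The factorisation \<open>P\<^sup>2 - m\<^sup>2 = (P + m) (P - m)\<close>: as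
      \<open>P\<close> is positive, \<open>P + m\<close> is bounded below by \<open>m\<close>, so
      \<open>P x - m *\<^sub>R x\<close> is small as well.\<close>
    define w where "w = P x - m *\<^sub>R x"
    have Pw: "P w + m *\<^sub>R w = P (P x) - m\<^sup>2 *\<^sub>R x"
      by (simp add: w_def blinfun.diff_right blinfun.scaleR_right scaleR_diff_right power2_eq_square)
    have "m * (norm w * norm w) = inner w (m *\<^sub>R w)"
      by (simp add: power2_norm_eq_inner[symmetric] power2_eq_square)
    also have "\<dots> \<le> inner w (P w + m *\<^sub>R w)"
      using pos[of w] by (simp add: inner_add_right)
    also have "\<dots> \<le> norm w * norm (P (P x) - m\<^sup>2 *\<^sub>R x)"
      unfolding Pw by (rule norm_cauchy_schwarz)
    finally have "norm w * (m * norm w) \<le> norm w * norm (P (P x) - m\<^sup>2 *\<^sub>R x)"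
      by (simp add: mult.left_commute)
    then have "m * norm w \<le> norm (P (P x) - m\<^sup>2 *\<^sub>R x)"
      by (cases "w = 0") simp_all
    with less have "m * norm w < m * e"
      by linarith
    then have "norm w < e"
      using m by simp
    then show ?thesis
      using approx_eigenvector_mono[OF x(1) e1(2)] by (auto simp: w_def)
  qed
  show ?thesis
    using main upper by (intro exI[of _ m]) (auto simp: approx_eigenvector_insert V_def)
qed

lemma hermitian_inner:
  fixes T :: "'h::complex_hilbert \<Rightarrow>\<^sub>L 'h"
  shows "hermitian T \<Longrightarrow> inner (T x) y = inner x (T y)"
  by (metis Re_cinner hermitian_def)

text \<open>The operators for which the sequence \<open>x\<close> is asymptotically an eigenvector
  form a C*-algebra containing the tuple, once the same is demanded of their adjoints; the
  asymptotic eigenvalue is a character of it.\<close>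

lemma joint_spectrumI_approx:
  fixes S :: "('h::complex_hilbert \<Rightarrow>\<^sub>L 'h) ^ 'n" and B :: "'h set"
  assumes B: "orthonormal_basis B" and S: "\<And>i. hermitian (S $ i)"
    and x: "\<And>k. norm (x k) = 1"
    and lim: "\<And>i. (\<lambda>k. (S $ i) (x k) - (\<mu> $ i) *\<^sub>R x k) \<longlonglongrightarrow> 0"
  shows "\<mu> \<in> joint_spectrum S"
proof -
  define ev where "ev T c \<longleftrightarrow> (\<lambda>k. blinfun_apply T (x k) - c *\<^sub>C x k) \<longlonglongrightarrow> 0" for T :: "'h \<Rightarrow>\<^sub>L 'h" and c
  \<comment> \<open>An approximate eigenvector of \<open>T\<close> need not be one of
    \<open>adj_op T\<close>; the second condition makes \<open>N\<close> closed under
    adjoints.\<close>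
  define N where "N = {T \<in> bounded_ops. \<exists>c. ev T c \<and> ev (adj_op T) (cnj c)}"
  \<comment> \<open>The limit exists whenever \<open>ev T c\<close> holds and then equals
    \<open>c\<close>; so the asymptotic eigenvalue is unique and \<open>\<phi>\<close> is well
    defined on \<open>N\<close>.\<close>
  define \<phi> where "\<phi> T = Topological_Spaces.lim (\<lambda>k. cinner (x k) (blinfun_apply T (x k)))" for T
  have xx: "cinner (x k) (x k) = 1" for k
    using x[of k] by (simp add: cinner_self)
  have ev_cinner: "(\<lambda>k. cinner (x k) (T (x k))) \<longlonglongrightarrow> c" if "ev T c" for T :: "'h \<Rightarrow>\<^sub>L 'h" and c
  proof -
    have "(\<lambda>k. cinner (x k) (T (x k)) - c) \<longlonglongrightarrow> 0"
    proof (rule Lim_null_comparison)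
      show "(\<lambda>k. norm (T (x k) - c *\<^sub>C x k)) \<longlonglongrightarrow> 0"
        using that unfolding ev_def by (rule tendsto_norm_zero)
      have "cinner (x k) (T (x k)) - c = cinner (x k) (T (x k) - c *\<^sub>C x k)" for k
        by (simp add: cinner.diff_right cinner_scaleC_right xx)
      then show "\<forall>\<^sub>F k in sequentially. norm (cinner (x k) (T (x k)) - c) \<le> norm (T (x k) - c *\<^sub>C x k)"
        using cmod_cinner_le[of "x k" "T (x k) - c *\<^sub>C x k" for k] by (simp add: x)
    qed
    then show ?thesis
      by (simp add: LIM_zero_iff)
  qed
  have \<phi>: "\<phi> T = c" if "ev T c" for T :: "'h \<Rightarrow>\<^sub>L 'h" and c
    unfolding \<phi>_def by (rule limI[OF ev_cinner[OF that]])
  have ev_norm: "cmod c \<le> norm T" if "ev T c" for T :: "'h \<Rightarrow>\<^sub>L 'h" and c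
  proof (rule Lim_bounded)
    show "(\<lambda>k. cmod (cinner (x k) (T (x k)))) \<longlonglongrightarrow> cmod c"
      by (rule tendsto_norm[OF ev_cinner[OF that]])
    show "\<forall>k\<ge>0. cmod (cinner (x k) (T (x k))) \<le> norm T"
      using cmod_cinner_le[of "x k" "T (x k)" for k] norm_blinfun[of T "x k" for k] x
      by (metis mult_1 mult.right_neutral order_trans)
  qed
  have ev_add: "ev (T + R) (c + d)" if "ev T c" "ev R d" for T R :: "'h \<Rightarrow>\<^sub>L 'h" and c d
    using tendsto_add[OF that[unfolded ev_def]]
    by (simp add: ev_def blinfun.add_left scaleC_add_left algebra_simps)
  have ev_diff: "ev (T - R) (c - d)" if "ev T c" "ev R d" for T R :: "'h \<Rightarrow>\<^sub>L 'h" and c d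
    using tendsto_diff[OF that[unfolded ev_def]]
    by (simp add: ev_def blinfun.diff_left scaleC.diff_left algebra_simps)
  have ev_scale: "ev (scaleC_op d T) (d * c)" if "ev T c" for T :: "'h \<Rightarrow>\<^sub>L 'h" and c d
    using bounded_linear.tendsto[OF scaleC.bounded_linear_right that[unfolded ev_def], of d]
    by (simp add: ev_def scaleC_op_apply scaleC.diff_right scaleC_scaleC scaleC.zero_right)
  have ev_compose: "ev (T o\<^sub>L R) (c * d)" if T: "T \<in> bounded_ops" and "ev T c" "ev R d" for T R :: "'h \<Rightarrow>\<^sub>L 'h" and c d
  proof -
    have "(\<lambda>k. T (R (x k) - d *\<^sub>C x k) + d *\<^sub>C (T (x k) - c *\<^sub>C x k)) \<longlonglongrightarrow> T 0 + d *\<^sub>C 0"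
      using that(2,3) unfolding ev_def
      by (intro tendsto_add bounded_linear.tendsto[OF scaleC.bounded_linear_right]
          bounded_linear.tendsto[OF blinfun.bounded_linear_right])
    then show ?thesis
      by (simp add: ev_def blinfun.diff_right bounded_opsD[OF T] scaleC.diff_right scaleC_scaleC
          scaleC.zero_right blinfun.zero_right mult.commute)
  qed
  have ev_limit: "ev T c" if T: "F \<longlonglongrightarrow> T" and c: "d \<longlonglongrightarrow> c" and ev: "\<And>j. ev (F j) (d j)"
    for F :: "nat \<Rightarrow> 'h \<Rightarrow>\<^sub>L 'h" and T :: "'h \<Rightarrow>\<^sub>L 'h" and c d
    unfolding ev_def
  proof (rule tendstoI)
    fix e :: real assume "e > 0"
    then have "\<forall>\<^sub>F j in sequentially. dist (F j) T < e / 3 \<and> dist (d j) c < e / 3"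
      using T c by (intro eventually_conj tendstoD) auto
    then obtain j where j: "dist (F j) T < e / 3" "dist (d j) c < e / 3"
      by (auto simp: eventually_sequentially)
    have "\<forall>\<^sub>F k in sequentially. dist (F j (x k) - d j *\<^sub>C x k) 0 < e / 3"
      using ev[of j] \<open>e > 0\<close> unfolding ev_def by (intro tendstoD) auto
    then show "\<forall>\<^sub>F k in sequentially. dist (T (x k) - c *\<^sub>C x k) 0 < e"
    proof eventually_elim
      case (elim k)
      have "T (x k) - c *\<^sub>C x k = (T - F j) (x k) + (d j - c) *\<^sub>C x k + (F j (x k) - d j *\<^sub>C x k)"
        by (simp add: blinfun.diff_left scaleC.diff_left)
      then have "norm (T (x k) - c *\<^sub>C x k)
          \<le> norm ((T - F j) (x k)) + norm ((d j - c) *\<^sub>C x k) + norm (F j (x k) - d j *\<^sub>C x k)"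
        by (metis norm_triangle_ineq norm_triangle_mono order_refl)
      also have "\<dots> \<le> norm (T - F j) + cmod (d j - c) + norm (F j (x k) - d j *\<^sub>C x k)"
        using norm_blinfun[of "T - F j" "x k"] by (simp add: norm_scaleC x)
      also have "\<dots> < e"
        using j elim by (simp add: dist_norm norm_minus_commute)
      finally show ?case
        by simp
    qed
  qed
  have "unital_cstar_subalgebra N"
    unfolding unital_cstar_subalgebra_def
  proof (intro conjI ballI allI)
    show "N \<subseteq> bounded_ops"
      by (auto simp: N_def)
    show "id_blinfun \<in> N"
      by (auto simp: N_def bounded_ops_id adj_op_id ev_def scaleC_one intro!: exI[of _ 1])
  next
    show "closed N"
      unfolding closed_sequential_limits
    proof (intro allI impI, elim conjE)
      fix F T assume F: "\<forall>j. F j \<in> N" and T: "F \<longlonglongrightarrow> T"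
      have Fb: "F j \<in> bounded_ops" for j
        using F by (auto simp: N_def)
      then have Tb: "T \<in> bounded_ops"
        using closed_sequentially[OF closed_bounded_ops _ T] by blast
      obtain d where d: "\<And>j. ev (F j) (d j)" "\<And>j. ev (adj_op (F j)) (cnj (d j))"
        using F unfolding N_def mem_Collect_eq by metis
      \<comment> \<open>An asymptotic eigenvalue is bounded by the norm of its operator; applied to
        differences, this makes the eigenvalues converge along with the operators.\<close>
      have "Cauchy d"
      proof (rule metric_CauchyI)
        fix e :: real assume "e > 0"
        then obtain M where M: "\<And>j l. j \<ge> M \<Longrightarrow> l \<ge> M \<Longrightarrow> dist (F j) (F l) < e"
          using metric_CauchyD[OF LIMSEQ_imp_Cauchy[OF T]] by metis
        have "dist (d j) (d l) \<le> dist (F j) (F l)" for j l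
          unfolding dist_norm by (rule ev_norm[OF ev_diff[OF d(1) d(1)]])
        then show "\<exists>M. \<forall>j\<ge>M. \<forall>l\<ge>M. dist (d j) (d l) < e"
          using M le_less_trans by blast
      qed
      then obtain c where c: "d \<longlonglongrightarrow> c"
        by (auto simp: Cauchy_convergent_iff convergent_def)
      have "(\<lambda>j. adj_op (F j) - adj_op T) \<longlonglongrightarrow> 0"
      proof (rule Lim_null_comparison)
        show "\<forall>\<^sub>F j in sequentially. norm (adj_op (F j) - adj_op T) \<le> norm (F j - T)"
          by (simp add: adj_op_diff[OF B Fb Tb, symmetric] norm_adj_op_le[OF B] bounded_ops_diff Fb Tb)
        show "(\<lambda>j. norm (F j - T)) \<longlonglongrightarrow> 0"
          using T by (simp add: LIM_zero_iff tendsto_norm_zero)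
      qed
      then have "(\<lambda>j. adj_op (F j)) \<longlonglongrightarrow> adj_op T"
        by (simp add: LIM_zero_iff)
      then have "ev (adj_op T) (cnj c)"
        using tendsto_cnj[OF c] d(2) by (rule ev_limit)
      moreover have "ev T c"
        using T c d(1) by (rule ev_limit)
      ultimately show "T \<in> N"
        using Tb by (auto simp: N_def)
    qed
  next
    fix T R assume "T \<in> N" "R \<in> N"
    then obtain c d where *: "T \<in> bounded_ops" "R \<in> bounded_ops" "ev T c" "ev R d"
      "ev (adj_op T) (cnj c)" "ev (adj_op R) (cnj d)"
      by (auto simp: N_def)
    note adj = adj_op_bounded_ops[OF B]
    have "ev (T + R) (c + d)" "ev (adj_op (T + R)) (cnj (c + d))"
      using * by (auto simp: adj_op_add[OF B] intro: ev_add)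
    then show "T + R \<in> N"
      using bounded_ops_add[OF *(1,2)] unfolding N_def by blast
    have "ev (T o\<^sub>L R) (c * d)" "ev (adj_op (T o\<^sub>L R)) (cnj (c * d))"
      using * ev_compose[OF *(1,3,4)] ev_compose[OF adj[OF *(2)] *(6,5)]
      by (auto simp: adj_op_compose[OF B] mult.commute)
    then show "T o\<^sub>L R \<in> N"
      using bounded_ops_compose[OF *(1,2)] unfolding N_def by blast
  next
    fix T and a :: complex assume "T \<in> N"
    then obtain c where *: "T \<in> bounded_ops" "ev T c" "ev (adj_op T) (cnj c)"
      by (auto simp: N_def)
    have "ev (scaleC_op a T) (a * c)" "ev (adj_op (scaleC_op a T)) (cnj (a * c))"
      using * by (auto simp: adj_op_scaleC[OF B] intro: ev_scale)
    then show "scaleC_op a T \<in> N"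
      using bounded_ops_scaleC[OF *(1)] unfolding N_def by blast
  next
    fix T assume "T \<in> N"
    then obtain c where *: "T \<in> bounded_ops" "ev T c" "ev (adj_op T) (cnj c)"
      by (auto simp: N_def)
    then show "adj_op T \<in> N"
      using adj_op_bounded_ops[OF B] adj_op_adj_op[OF B] unfolding N_def
      by (auto intro!: exI[of _ "cnj c"])
  qed
  moreover have evS: "ev (S $ i) (complex_of_real (\<mu> $ i))" for i
    using lim[of i] by (simp add: ev_def scaleC_of_real)
  have "S $ i \<in> N" for i
    using S[of i] evS[of i] adj_op_hermitian[OF S]
    by (auto simp: N_def hermitian_def intro!: exI[of _ "complex_of_real (\<mu> $ i)"])
  ultimately have sub: "unital_cstar_subalgebra hull range (($) S) \<subseteq> N"
    by (intro hull_minimal) auto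
  have "character_on N \<phi>"
    unfolding character_on_def
  proof (intro conjI ballI allI)
    show "\<phi> id_blinfun = 1"
      by (rule \<phi>) (simp add: ev_def scaleC_one)
    fix T R assume "T \<in> N" "R \<in> N"
    then obtain c d where *: "T \<in> bounded_ops" "ev T c" "ev R d"
      by (auto simp: N_def)
    show "\<phi> (T + R) = \<phi> T + \<phi> R" "\<phi> (T o\<^sub>L R) = \<phi> T * \<phi> R"
      using \<phi>[OF *(2)] \<phi>[OF *(3)] \<phi>[OF ev_add[OF *(2,3)]] \<phi>[OF ev_compose[OF *]] by simp_all
  next
    fix T and a :: complex assume "T \<in> N"
    then obtain c where *: "ev T c"
      by (auto simp: N_def)
    show "\<phi> (scaleC_op a T) = a * \<phi> T"
      using \<phi>[OF *] \<phi>[OF ev_scale[OF *]] by simp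
  qed
  then have "character_on (unital_cstar_subalgebra hull range (($) S)) \<phi>"
    using sub by (rule character_on_subset)
  then show ?thesis
    using \<phi>[OF evS] unfolding joint_spectrum_def by blast
qed

section \<open>The joint numerical range\<close>

text \<open>The maximum of the functional \<open>a\<close> over the numerical values is an
  approximate eigenvalue of the combination \<open>T\<close> of the \<open>S $ i\<close>. Refining
  its approximate eigenvectors until they serve every \<open>S $ i\<close> yields a spectral point
  on which \<open>a\<close> takes that maximum.\<close>

lemma joint_spectrum_support:
  fixes S :: "('h::complex_hilbert \<Rightarrow>\<^sub>L 'h) ^ 'n" and B :: "'h set" and a :: "real ^ 'n"
  assumes B: "orthonormal_basis B" and S: "\<And>i. hermitian (S $ i)"
    and commute: "\<And>i j. S $ i o\<^sub>L S $ j = S $ j o\<^sub>L S $ i" and x0: "norm x0 = 1"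
  obtains \<mu> where "\<mu> \<in> joint_spectrum S" "inner a (\<chi> i. Re (cinner x0 ((S $ i) x0))) \<le> inner a \<mu>"
proof -
  have SS: "(S $ i) ((S $ j) x) = (S $ j) ((S $ i) x)" for i j x
    by (metis commute blinfun_apply_blinfun_compose)
  define T where "T = (\<Sum>i\<in>UNIV. (a $ i) *\<^sub>R (S $ i))"
  have T: "T x = (\<Sum>i\<in>UNIV. (a $ i) *\<^sub>R (S $ i) x)" for x
    by (simp add: T_def blinfun.sum_left blinfun.scaleR_left)
  \<comment> \<open>Adding the norm makes a symmetric operator positive, as the extension lemma
    demands, and merely translates its eigenvalues.\<close>
  define shift where "shift R = R + norm R *\<^sub>R id_blinfun" for R :: "'h \<Rightarrow>\<^sub>L 'h"
  have shift: "shift R x = R x + norm R *\<^sub>R x" for R x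
    by (simp add: shift_def blinfun.add_left blinfun.scaleR_left)
  have shift_pos: "0 \<le> inner x (shift R x)" for R x
  proof -
    have "\<bar>inner x (R x)\<bar> \<le> norm x * norm (R x)"
      by (rule Cauchy_Schwarz_ineq2)
    also have "\<dots> \<le> norm x * (norm R * norm x)"
      by (intro mult_left_mono norm_blinfun) simp
    also have "\<dots> = norm R * inner x x"
      by (simp add: power2_norm_eq_inner[symmetric] power2_eq_square)
    finally show ?thesis
      by (simp add: shift inner_add_right)
  qed
  have symS: "inner ((S $ i) x) y = inner x ((S $ i) y)" for i x y
    by (rule hermitian_inner[OF S])
  have symT: "inner (T x) y = inner x (T y)" for x y
    by (simp add: T inner_sum_left inner_sum_right symS)
  have shift_sym: "inner (shift R x) y = inner x (shift R y)"
    if "\<And>x y. inner (R x) y = inner x (R y)" for R :: "'h \<Rightarrow>\<^sub>L 'h" and x y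
    by (simp add: shift inner_add_left inner_add_right that)
  have "\<forall>e>0. \<exists>x::'h. approx_eigenvector {} e x"
    using x0 by (auto simp: approx_eigenvector_def)
  \<comment> \<open>\<open>T\<close> must come first: with no constraints yet, every unit vector
    qualifies, so maximality of \<open>m\<close> covers \<open>x0\<close>. The later extensions only
    have to keep the pair \<open>(shift T, m)\<close>.\<close>
  from approx_eigenvector_extend[OF shift_sym[OF symT] shift_pos _ this]
  obtain m where m: "\<forall>e>0. \<exists>x. approx_eigenvector {(shift T, m)} e x"
    "\<forall>\<nu>. (\<forall>e>0. \<exists>x. approx_eigenvector {} e x \<and> \<nu> \<le> norm (shift T x)) \<longrightarrow> \<nu> \<le> m"
    by auto
  have "inner x0 (T x0) + norm T = inner x0 (shift T x0)"
    using x0 by (simp add: shift inner_add_right power2_norm_eq_inner[symmetric])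
  also have "\<dots> \<le> norm (shift T x0)"
    using norm_cauchy_schwarz[of x0 "shift T x0"] x0 by simp
  also have "\<dots> \<le> m"
    using x0 by (intro m(2)[rule_format]) (auto simp: approx_eigenvector_def)
  finally have lower: "inner x0 (T x0) + norm T \<le> m" .
  have "\<exists>\<mu>. \<forall>e>0. \<exists>x. approx_eigenvector (insert (shift T, m) ((\<lambda>i. (S $ i, \<mu> i)) ` J)) e x"
    if "finite J" for J :: "'n set"
    using that
  proof induction
    case empty
    show ?case
      using m(1) by simp
  next
    case (insert i J)
    then obtain \<mu> where \<mu>: "\<forall>e>0. \<exists>x. approx_eigenvector (insert (shift T, m) ((\<lambda>i. (S $ i, \<mu> i)) ` J)) e x"
      (is "\<forall>e>0. \<exists>x. approx_eigenvector ?L e x")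
      by blast
    have "\<forall>(R, r)\<in>?L. \<forall>x. shift (S $ i) (blinfun_apply R x) = blinfun_apply R (shift (S $ i) x)"
      by (auto simp: shift T SS blinfun.add_right blinfun.scaleR_right blinfun.sum_right
          scaleR_sum_right scaleR_add_right sum.distrib algebra_simps)
    from approx_eigenvector_extend[OF shift_sym[OF symS] shift_pos this \<mu>]
    obtain m' where m': "\<forall>e>0. \<exists>x. approx_eigenvector (insert (shift (S $ i), m') ?L) e x"
      by blast
    \<comment> \<open>Undoing the shift gives \<open>S $ i\<close> the eigenvalue
      \<open>m' - norm (S $ i)\<close>; as \<open>i\<close> is not in \<open>J\<close>, the update
      leaves the earlier eigenvalues alone.\<close>
    have "approx_eigenvector (insert (shift T, m) ((\<lambda>j. (S $ j, (\<mu>(i := m' - norm (S $ i))) j)) ` insert i J)) e x"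
      if "approx_eigenvector (insert (shift (S $ i), m') ?L) e x" for e x
      using that insert.hyps(2) by (auto simp: approx_eigenvector_def shift algebra_simps)
    with m' show ?case
      by blast
  qed
  from this[OF finite_class.finite_UNIV] obtain \<mu> where \<mu>: "\<forall>e>0.
      \<exists>x. approx_eigenvector (insert (shift T, m) (range (\<lambda>i. (S $ i, \<mu> i)))) e x"
    by blast
  then have "\<exists>x. approx_eigenvector (insert (shift T, m) (range (\<lambda>i. (S $ i, \<mu> i)))) (1 / real (Suc k)) x" for k
    by simp
  then obtain x where x: "\<And>k. approx_eigenvector (insert (shift T, m) (range (\<lambda>i. (S $ i, \<mu> i)))) (1 / real (Suc k)) (x k)"
    by metis
  have nx: "norm (x k) = 1" for k
    using x[of k] by (simp add: approx_eigenvector_def)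
  have lim: "(\<lambda>k. R (x k) - r *\<^sub>R x k) \<longlonglongrightarrow> 0"
    if "(R, r) \<in> insert (shift T, m) (range (\<lambda>i. (S $ i, \<mu> i)))" for R r
  proof (rule Lim_null_comparison)
    show "\<forall>\<^sub>F k in sequentially. norm (R (x k) - r *\<^sub>R x k) \<le> 1 / real (Suc k)"
      using x that unfolding approx_eigenvector_def by (intro always_eventually allI less_imp_le) blast
    show "(\<lambda>k. 1 / real (Suc k)) \<longlonglongrightarrow> 0"
      using LIMSEQ_inverse_real_of_nat by (simp add: inverse_eq_divide)
  qed
  have limS: "(\<lambda>k. (S $ i) (x k) - \<mu> i *\<^sub>R x k) \<longlonglongrightarrow> 0" for i
    by (rule lim) simp
  \<comment> \<open>Subtracting the relations for the \<open>S $ i\<close> from the one for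
    \<open>shift T\<close> leaves \<open>?d *\<^sub>R x k\<close>, which tends to 0 although the
    \<open>x k\<close> are unit vectors; so \<open>?d\<close> vanishes.\<close>
  let ?d = "norm T + (\<Sum>i\<in>UNIV. a $ i * \<mu> i) - m"
  have "(\<lambda>k. (shift T (x k) - m *\<^sub>R x k) - (\<Sum>i\<in>UNIV. (a $ i) *\<^sub>R ((S $ i) (x k) - \<mu> i *\<^sub>R x k))) \<longlonglongrightarrow>
      0 - (\<Sum>i\<in>UNIV. (a $ i) *\<^sub>R 0)"
    by (intro tendsto_diff tendsto_sum tendsto_scaleR tendsto_const lim limS) simp
  moreover have "(shift T (x k) - m *\<^sub>R x k) - (\<Sum>i\<in>UNIV. (a $ i) *\<^sub>R ((S $ i) (x k) - \<mu> i *\<^sub>R x k)) = ?d *\<^sub>R x k" for k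
    by (simp add: shift T scaleR_diff_right sum_subtractf scaleR_sum_left algebra_simps)
  ultimately have "(\<lambda>k. ?d *\<^sub>R x k) \<longlonglongrightarrow> 0"
    by simp
  from tendsto_norm[OF this] have "(\<lambda>k::nat. \<bar>?d\<bar>) \<longlonglongrightarrow> 0"
    by (simp add: nx)
  then have "?d = 0"
    by (simp add: LIMSEQ_const_iff)
  moreover have "inner a (\<chi> i. Re (cinner x0 ((S $ i) x0))) = inner x0 (T x0)"
    by (simp add: inner_vec_def T inner_sum_right Re_cinner)
  ultimately have "inner a (\<chi> i. Re (cinner x0 ((S $ i) x0))) \<le> inner a (\<chi> i. \<mu> i)"
    using lower by (simp add: inner_vec_def)
  moreover have "(\<chi> i. \<mu> i) \<in> joint_spectrum S"
    using limS by (intro joint_spectrumI_approx[OF B S nx]) simp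
  ultimately show thesis
    using that by blast
qed

lemma joint_numerical_range_subset:
  fixes S :: "('h::complex_hilbert \<Rightarrow>\<^sub>L 'h) ^ 'n" and B :: "'h set"
  assumes B: "orthonormal_basis B" and S: "\<And>i. hermitian (S $ i)"
    and commute: "\<And>i j. S $ i o\<^sub>L S $ j = S $ j o\<^sub>L S $ i" and x: "norm x = 1"
    and C: "closed C" "convex C" "joint_spectrum S \<subseteq> C"
  shows "(\<chi> i. Re (cinner x ((S $ i) x))) \<in> C"
proof (rule ccontr)
  assume "\<not> ?thesis"
  from separating_hyperplane_closed_point[OF C(2,1) this]
  obtain a \<beta> where a: "inner a (\<chi> i. Re (cinner x ((S $ i) x))) < \<beta>" "\<And>y. y \<in> C \<Longrightarrow> \<beta> < inner a y"
    by blast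
  \<comment> \<open>The hyperplane has the numerical value on its lower side, whereas the support
    lemma bounds from above; hence \<open>- a\<close>.\<close>
  obtain \<mu> where "\<mu> \<in> joint_spectrum S"
    "inner (- a) (\<chi> i. Re (cinner x ((S $ i) x))) \<le> inner (- a) \<mu>"
    by (rule joint_spectrum_support[OF B S commute x, where a = "- a"])
  with a(1) a(2)[of \<mu>] C(3) show False
    by auto
qed

section \<open>Orthonormal bases with prescribed diagonal\<close>

text \<open>Each orthogonality condition lowers the dimension by at most one: modulo its solutions,
  \<open>V\<close> is spanned by any single vector \<open>u\<close> violating it.\<close>

lemma not_finite_cdim_orthogonal:
  fixes V :: "'h::complex_hilbert set"
  assumes "finite F" "complex_vector.subspace V" "\<not> finite_cdim V"
  shows "\<not> finite_cdim {x \<in> V. \<forall>v\<in>F. cinner v x = 0}"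
  using assms
proof (induction F arbitrary: V)
  case empty
  then show ?case
    by simp
next
  case (insert v F)
  let ?W = "{x \<in> V. cinner v x = 0}"
  have "complex_vector.subspace ?W"
    using insert.prems(1)
    by (auto simp: complex_vector.subspace_def cinner.zero_right cinner_add_right cinner_scaleC_right)
  moreover have "\<not> finite_cdim ?W"
  proof
    assume "finite_cdim ?W"
    then obtain G where G: "finite G" "?W \<subseteq> cspan G"
      by (auto simp: finite_cdim_def)
    show False
    proof (cases "\<exists>u\<in>V. cinner v u \<noteq> 0")
      case False
      then have "V \<subseteq> cspan G"
        using G(2) by auto
      then show False
        using insert.prems(2) G(1) by (auto simp: finite_cdim_def)
    next
      case True
      then obtain u where u: "u \<in> V" "cinner v u \<noteq> 0"
        by blast
      have "V \<subseteq> cspan (insert u G)"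
      proof
        fix x assume x: "x \<in> V"
        define c where "c = cinner v x / cinner v u"
        have "x - c *\<^sub>C u \<in> V"
          using complex_vector.subspace_diff[OF insert.prems(1) x]
            complex_vector.subspace_scale[OF insert.prems(1) u(1)] by blast
        moreover have "cinner v (x - c *\<^sub>C u) = 0"
          using u(2) by (simp add: cinner.diff_right cinner_scaleC_right c_def)
        ultimately have "x - c *\<^sub>C u \<in> cspan G"
          using G(2) by auto
        then show "x \<in> cspan (insert u G)"
          by (auto simp: complex_vector.span_insert)
      qed
      then show False
        using insert.prems(2) G(1) unfolding finite_cdim_def by (meson finite.insertI)
    qed
  qed
  ultimately have "\<not> finite_cdim {x \<in> ?W. \<forall>v\<in>F. cinner v x = 0}"
    by (rule insert.IH)
  moreover have "{x \<in> ?W. \<forall>v\<in>F. cinner v x = 0} = {x \<in> V. \<forall>v\<in>insert v F. cinner v x = 0}"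
    by auto
  ultimately show ?case
    by simp
qed

lemma unit_vector_orthogonal:
  fixes V :: "'h::complex_hilbert set"
  assumes "finite F" and V: "complex_vector.subspace V" "\<not> finite_cdim V"
  obtains x where "x \<in> V" "norm x = 1" "\<And>v. v \<in> F \<Longrightarrow> cinner v x = 0"
proof -
  let ?W = "{x \<in> V. \<forall>v\<in>F. cinner v x = 0}"
  \<comment> \<open>The span of the empty set is zero, so this supplies a nonzero vector.\<close>
  have "\<not> ?W \<subseteq> cspan {}"
    using not_finite_cdim_orthogonal[OF assms] unfolding finite_cdim_def by blast
  then obtain u where u: "u \<in> V" "\<And>v. v \<in> F \<Longrightarrow> cinner v u = 0" "u \<noteq> 0"
    by auto
  show thesis
  proof (rule that[of "complex_of_real (1 / norm u) *\<^sub>C u"])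
    show "norm (complex_of_real (1 / norm u) *\<^sub>C u) = 1"
      using u(3) by (simp add: norm_scaleC norm_divide)
  qed (use u complex_vector.subspace_scale[OF V(1)] in \<open>simp_all add: cinner_scaleC_right\<close>)
qed

lemma subspace_joint_eigenspace:
  fixes S :: "('h::complex_hilbert \<Rightarrow>\<^sub>L 'h) ^ 'n"
  assumes "\<And>i. hermitian (S $ i)"
  shows "complex_vector.subspace (joint_eigenspace S \<mu>)"
  using assms unfolding complex_vector.subspace_def joint_eigenspace_def hermitian_def
  by (simp add: blinfun.zero_right blinfun.add_right scaleR_add_right bounded_opsD)
    (simp add: scaleC_scaleC mult.commute flip: scaleC_of_real)

lemma joint_eigenspace_orthogonal:
  fixes S :: "('h::complex_hilbert \<Rightarrow>\<^sub>L 'h) ^ 'n"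
  assumes S: "\<And>i. hermitian (S $ i)"
    and "x \<in> joint_eigenspace S \<mu>" "y \<in> joint_eigenspace S \<nu>" "\<mu> \<noteq> \<nu>"
  shows "cinner x y = 0"
proof -
  obtain i where i: "\<mu> $ i \<noteq> \<nu> $ i"
    using assms(4) by (auto simp: vec_eq_iff)
  have "cinner ((S $ i) x) y = cinner x ((S $ i) y)"
    using S[of i] by (simp add: hermitian_def)
  then show ?thesis
    using assms(2,3) i by (simp add: joint_eigenspace_def cinner_scaleR_left cinner_scaleR_right)
qed

text \<open>Joint eigenvectors for distinct points are orthogonal, so a combination with
  coefficients the square roots of the convex weights is a unit vector whose numerical value is the
  corresponding convex combination of the points.\<close>

lemma convex_hull_numerical_value:
  fixes S :: "('h::complex_hilbert \<Rightarrow>\<^sub>L 'h) ^ 'n"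
  assumes S: "\<And>i. hermitian (S $ i)" and X: "finite X" "\<And>\<mu>. \<mu> \<in> X \<Longrightarrow> \<not> finite_cdim (joint_eigenspace S \<mu>)"
    and p: "p \<in> convex hull X" and F: "finite F"
  obtains z where "norm z = 1" "\<And>v. v \<in> F \<Longrightarrow> cinner v z = 0"
    "\<And>i. cinner z ((S $ i) z) = complex_of_real (p $ i)"
proof -
  obtain t where t: "\<And>\<mu>. \<mu> \<in> X \<Longrightarrow> 0 \<le> t \<mu>" "sum t X = 1" "(\<Sum>\<mu>\<in>X. t \<mu> *\<^sub>R \<mu>) = p"
    using p by (auto simp: convex_hull_finite[OF X(1)])
  have "\<exists>x. x \<in> joint_eigenspace S \<mu> \<and> norm x = 1 \<and> (\<forall>v\<in>F. cinner v x = 0)" if "\<mu> \<in> X" for \<mu>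
    by (rule unit_vector_orthogonal[OF F subspace_joint_eigenspace[OF S] X(2)[OF that]]) blast
  then obtain e where e: "\<And>\<mu>. \<mu> \<in> X \<Longrightarrow> e \<mu> \<in> joint_eigenspace S \<mu>" "\<And>\<mu>. \<mu> \<in> X \<Longrightarrow> norm (e \<mu>) = 1"
    "\<And>\<mu> v. \<mu> \<in> X \<Longrightarrow> v \<in> F \<Longrightarrow> cinner v (e \<mu>) = 0"
    by metis
  have on: "orthonormal_on X e"
    using joint_eigenspace_orthogonal[OF S e(1) e(1)] e(2) by (auto simp: orthonormal_on_def cinner_self)
  note sums = cinner_sum_sum_orthonormal[OF on X(1) subset_refl]
  define c where "c \<mu> = complex_of_real (sqrt (t \<mu>))" for \<mu>
  have cc: "cnj (c \<mu>) * c \<mu> = complex_of_real (t \<mu>)" if "\<mu> \<in> X" for \<mu>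
    using t(1)[OF that] by (simp add: c_def of_real_mult[symmetric] del: of_real_mult)
  define z where "z = (\<Sum>\<mu>\<in>X. c \<mu> *\<^sub>C e \<mu>)"
  show thesis
  proof (rule that[of z])
    have "(norm z)\<^sup>2 = (\<Sum>\<mu>\<in>X. (cmod (c \<mu>))\<^sup>2)"
      unfolding z_def by (rule norm_sum_orthonormal[OF on X(1) subset_refl])
    also have "\<dots> = sum t X"
      using t(1) by (intro sum.cong) (simp_all add: c_def)
    finally show "norm z = 1"
      using t(2) by (simp add: power2_eq_1_iff) (metis norm_ge_zero neg_0_le_iff_le not_one_le_zero)
    show "cinner v z = 0" if "v \<in> F" for v
      using e(3)[OF _ that] by (simp add: z_def cinner.sum_right cinner_scaleC_right)
    fix i
    have Si: "S $ i \<in> bounded_ops"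
      using S by (auto simp: hermitian_def)
    have "(S $ i) z = (\<Sum>\<mu>\<in>X. (c \<mu> * complex_of_real (\<mu> $ i)) *\<^sub>C e \<mu>)"
      using e(1) by (simp add: z_def blinfun.sum_right bounded_opsD[OF Si] joint_eigenspace_def scaleC_of_real
          flip: scaleC_scaleC)
    then have "cinner z ((S $ i) z) = (\<Sum>\<mu>\<in>X. cnj (c \<mu>) * (c \<mu> * complex_of_real (\<mu> $ i)))"
      by (simp only: z_def sums)
    also have "\<dots> = (\<Sum>\<mu>\<in>X. complex_of_real (t \<mu> * \<mu> $ i))"
      by (intro sum.cong refl) (simp add: cc mult.assoc[symmetric])
    also have "\<dots> = complex_of_real (p $ i)"
      by (simp add: t(3)[symmetric])
    finally show "cinner z ((S $ i) z) = complex_of_real (p $ i)" .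
  qed
qed

section \<open>Block construction of a total orthonormal sequence\<close>

lemma orthonormal_sequence_extend:
  fixes F :: "'h::complex_hilbert set" and Q :: "nat \<Rightarrow> 'h \<Rightarrow> bool" and N :: nat
  assumes Q: "\<And>F j. finite F \<Longrightarrow> \<exists>z::'h. norm z = 1 \<and> (\<forall>v\<in>F. cinner v z = 0) \<and> Q j z" and F: "finite F"
  shows "\<exists>z. orthonormal_on {..<N} z \<and> (\<forall>j<N. Q j (z j) \<and> (\<forall>v\<in>F. cinner v (z j) = 0))"
proof (induction N)
  case 0
  then show ?case
    by (simp add: orthonormal_on_def)
next
  case (Suc N)
  then obtain z where z: "orthonormal_on {..<N} z" "\<And>j. j < N \<Longrightarrow> Q j (z j)"
    "\<And>j v. j < N \<Longrightarrow> v \<in> F \<Longrightarrow> cinner v (z j) = 0"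
    by blast
  obtain x where x: "norm x = 1" "\<And>v. v \<in> F \<union> z ` {..<N} \<Longrightarrow> cinner v x = 0" "Q N x"
    using Q[of "F \<union> z ` {..<N}" N] F by auto
  then have "cinner (z j) x = 0" "cinner x (z j) = 0" if "j < N" for j
    using that cinner_eq_0_commute[of x "z j"] by auto
  then have "orthonormal_on {..<Suc N} (z(N := x))"
    using z(1) cinner_self[of x] x(1) by (auto simp: orthonormal_on_def less_Suc_eq)
  moreover have "\<forall>j<Suc N. Q j ((z(N := x)) j) \<and> (\<forall>v\<in>F. cinner v ((z(N := x)) j) = 0)"
    using z x by (auto simp: less_Suc_eq)
  ultimately show ?case
    by blast
qed

text \<open>Rotating the normalised sum \<open>w\<close> of the vectors \<open>z\<^sub>j\<close> onto \<open>g\<close> moves each \<open>z\<^sub>j\<close> by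
  \<open>\<parallel>g - w\<parallel> / \<surd>N\<close> only, and puts \<open>g\<close> into the span.\<close>

lemma orthonormal_block_absorb:
  fixes g :: "'h::complex_hilbert" and N :: nat
  assumes z: "orthonormal_on {..<N} z" "\<And>j. j < N \<Longrightarrow> cinner g (z j) = 0" and g: "norm g = 1" and N: "N > 0"
  defines "w \<equiv> (1 / sqrt N) *\<^sub>R (\<Sum>j<N. z j)"
  defines "y \<equiv> \<lambda>j. z j + (1 / sqrt N) *\<^sub>R (g - w)"
  shows "orthonormal_on {..<N} y" "g \<in> cspan (y ` {..<N})" "norm (y j - z j) \<le> 2 / sqrt N"
proof -
  define s where "s = 1 / sqrt (real N)"
  have s: "s * s * N = 1" "s > 0"
    using N by (simp_all add: s_def)
  have zw: "cinner (z j) w = s" if "j < N" for j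
  proof -
    have "cinner (z j) (\<Sum>i<N. z i) = (\<Sum>i<N. if j = i then 1 else 0)"
      unfolding cinner.sum_right using z(1) that by (intro sum.cong) (auto simp: orthonormal_onD)
    then show ?thesis
      using that by (simp add: w_def cinner_scaleR_right s_def)
  qed
  have wz: "cinner w (z j) = s" if "j < N" for j
    using zw[OF that] cinner_commute[of w "z j"] by simp
  have gw: "cinner g w = 0"
    using z(2) by (simp add: w_def cinner_scaleR_right cinner.sum_right)
  then have wg: "cinner w g = 0"
    by (simp add: cinner_eq_0_commute)
  have zg: "cinner (z j) g = 0" if "j < N" for j
    using z(2)[OF that] by (simp add: cinner_eq_0_commute)
  have "cinner w w = complex_of_real s * (\<Sum>j<N. cinner w (z j))"
    by (subst (2) w_def) (simp add: cinner_scaleR_right cinner.sum_right s_def)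
  also have "\<dots> = complex_of_real (s * s * N)"
    by (simp add: wz)
  finally have ww: "cinner w w = 1"
    using s(1) by simp
  have gg: "cinner g g = 1"
    using g by (simp add: cinner_self)
  note simps = cinner_add_left cinner_add_right cinner_scaleR_left cinner_scaleR_right
    cinner.diff_left cinner.diff_right zw wz gw wg zg z(2) ww gg
  have y: "y j = z j + s *\<^sub>R (g - w)" for j
    by (simp add: y_def s_def)
  \<comment> \<open>The two cross terms with \<open>g - w\<close> contribute
    \<open>- 2 * s * s\<close>, which cancels \<open>s * s\<close> times the squared norm 2 of
    \<open>g - w\<close>.\<close>
  show "orthonormal_on {..<N} y"
    unfolding orthonormal_on_def
  proof (intro ballI)
    fix i j assume "i \<in> {..<N}" "j \<in> {..<N}"
    then show "cinner (y i) (y j) = (if i = j then 1 else 0)"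
      using orthonormal_onD[OF z(1), of i j] by (simp add: y simps algebra_simps)
  qed
  \<comment> \<open>The normalised sum of the \<open>z j\<close> is \<open>w\<close>; that of the
    \<open>y j\<close> is \<open>w + (g - w)\<close>, because \<open>s * s * N = 1\<close>.\<close>
  have "(\<Sum>j<N. y j) = (\<Sum>j<N. z j) + (s * N) *\<^sub>R (g - w)"
    by (simp add: y sum.distrib sum_constant_scaleR mult.commute)
  then have "s *\<^sub>R (\<Sum>j<N. y j) = w + (s * s * N) *\<^sub>R (g - w)"
    by (simp add: scaleR_add_right w_def s_def)
  then have "g = complex_of_real s *\<^sub>C (\<Sum>j<N. y j)"
    using s(1) by (simp add: scaleC_of_real)
  moreover have "complex_of_real s *\<^sub>C (\<Sum>j<N. y j) \<in> cspan (y ` {..<N})"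
    by (intro complex_vector.span_scale complex_vector.span_sum complex_vector.span_base) auto
  ultimately show "g \<in> cspan (y ` {..<N})"
    by simp
  have "norm w = 1"
    using ww by (simp add: cinner_self power2_eq_1_iff del: of_real_power)
      (metis norm_ge_zero neg_0_le_iff_le not_one_le_zero)
  then have "norm (g - w) \<le> 2"
    using norm_triangle_ineq4[of g w] g by simp
  moreover have "norm (y j - z j) = s * norm (g - w)"
    using s(2) by (simp add: y)
  ultimately show "norm (y j - z j) \<le> 2 / sqrt N"
    using s(2) mult_left_mono[of "norm (g - w)" 2 s] by (simp add: s_def)
qed

text \<open>\<open>P\<close> holds the vectors already chosen and \<open>e\<close> is the vector to
  be captured. Only the component of \<open>e\<close> orthogonal to \<open>P\<close> is missing, so
  absorbing its direction \<open>g\<close> is enough.\<close>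

lemma orthonormal_block:
  fixes P :: "'h::complex_hilbert set" and Q :: "nat \<Rightarrow> 'h \<Rightarrow> bool" and N :: nat
  assumes Q: "\<And>F j. finite F \<Longrightarrow> \<exists>z::'h. norm z = 1 \<and> (\<forall>v\<in>F. cinner v z = 0) \<and> Q j z"
    and P: "finite P" "orthonormal_on P (\<lambda>v. v)" and N: "N > 0"
  shows "\<exists>y. orthonormal_on {..<N} y \<and> (\<forall>j<N. \<forall>v\<in>P. cinner v (y j) = 0) \<and>
    e \<in> cspan (P \<union> y ` {..<N}) \<and> (\<forall>j<N. \<exists>z. norm z = 1 \<and> Q j z \<and> norm (y j - z) \<le> 2 / sqrt N)"
proof -
  let ?p = "\<Sum>v\<in>P. cinner v e *\<^sub>C v"
  have orth: "cinner v (e - ?p) = 0" if "v \<in> P" for v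
    using cinner_sum_right_orthonormal[OF P(2,1) subset_refl that, of "\<lambda>v. cinner v e"] that
    by (simp add: cinner.diff_right)
  \<comment> \<open>If \<open>e\<close> already lies in the span of \<open>P\<close>, there is no
    direction to normalise; any unit vector orthogonal to \<open>P\<close> then serves, with
    \<open>r = 0\<close>.\<close>
  have "\<exists>g. norm g = 1 \<and> (\<forall>v\<in>P. cinner v g = 0) \<and> (\<exists>r. e - ?p = r *\<^sub>R g)"
  proof (cases "e - ?p = 0")
    case True
    then show ?thesis
      using Q[OF P(1), of 0] by (metis scaleR_zero_left)
  next
    case False
    let ?n = "norm (e - ?p)"
    have "norm ((1 / ?n) *\<^sub>R (e - ?p)) = 1" "e - ?p = ?n *\<^sub>R (1 / ?n) *\<^sub>R (e - ?p)"
      using False by simp_all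
    moreover have "cinner v ((1 / ?n) *\<^sub>R (e - ?p)) = 0" if "v \<in> P" for v
      by (simp only: cinner_scaleR_right orth[OF that] mult_zero_right)
    ultimately show ?thesis
      by blast
  qed
  then obtain g r where g: "norm g = 1" "\<And>v. v \<in> P \<Longrightarrow> cinner v g = 0" "e - ?p = r *\<^sub>R g"
    by blast
  obtain z where z: "orthonormal_on {..<N} z" "\<And>j. j < N \<Longrightarrow> Q j (z j)"
    "\<And>j v. j < N \<Longrightarrow> v \<in> insert g P \<Longrightarrow> cinner v (z j) = 0"
    using orthonormal_sequence_extend[of Q "insert g P" N, OF Q] P(1) by blast
  define w where "w = (1 / sqrt N) *\<^sub>R (\<Sum>j<N. z j)"
  define y where "y j = z j + (1 / sqrt N) *\<^sub>R (g - w)" for j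
  have absorb: "orthonormal_on {..<N} y" "g \<in> cspan (y ` {..<N})" "norm (y j - z j) \<le> 2 / sqrt N" for j
    using orthonormal_block_absorb[OF z(1) _ g(1) N] z(3) by (simp_all add: y_def[abs_def] w_def)
  have yP: "cinner v (y j) = 0" if "v \<in> P" "j < N" for v j
    using that g(2) z(3)
    by (simp add: y_def w_def cinner_add_right cinner_scaleR_right cinner.diff_right cinner.sum_right)
  have "g \<in> cspan (P \<union> y ` {..<N})"
    using absorb(2) complex_vector.span_mono[of "y ` {..<N}" "P \<union> y ` {..<N}"] by blast
  then have "?p + complex_of_real r *\<^sub>C g \<in> cspan (P \<union> y ` {..<N})"
    by (intro complex_vector.span_add complex_vector.span_scale complex_vector.span_sum)
      (auto intro: complex_vector.span_base)
  then have "e \<in> cspan (P \<union> y ` {..<N})"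
    using g(3) by (simp add: scaleC_of_real algebra_simps)
  then show ?thesis
    using absorb(1) yP
  proof (intro exI[of _ y] conjI allI impI ballI)
    fix j assume "j < N"
    then show "\<exists>z. norm z = 1 \<and> Q j z \<and> norm (y j - z) \<le> 2 / sqrt N"
      using absorb(3) z(2) orthonormal_on_norm[OF z(1)] by blast
  qed auto
qed

text \<open>Block \<open>k\<close> captures \<open>e k\<close>, so the span of the sequence contains
  a total set. The predicate \<open>Q n\<close> stands for the diagonal value prescribed at position
  \<open>n\<close>.\<close>

lemma orthonormal_sequence_total:
  fixes e :: "nat \<Rightarrow> 'h::complex_hilbert" and Q :: "nat \<Rightarrow> 'h \<Rightarrow> bool" and N :: nat
  assumes e: "closure (cspan (range e)) = UNIV" and N: "N > 0"
    and Q: "\<And>F n. finite F \<Longrightarrow> \<exists>z::'h. norm z = 1 \<and> (\<forall>v\<in>F. cinner v z = 0) \<and> Q n z"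
  obtains y where "orthonormal_on UNIV y" "closure (cspan (range y)) = UNIV"
    "\<And>n. \<exists>z. norm z = 1 \<and> Q n z \<and> norm (y n - z) \<le> 2 / sqrt (real N)"
proof -
  \<comment> \<open>A state consists of the union \<open>P\<close> of the earlier blocks and the
    current block \<open>w\<close>. Starting from the empty set ensures that \<open>P\<close>
    contains nothing but block members, all of which end up in the range of
    \<open>y\<close>.\<close>
  define inv where "inv k s \<longleftrightarrow> (case s of (P, w) \<Rightarrow> finite P \<and> orthonormal_on P (\<lambda>v. v) \<and> (k = 0 \<longrightarrow> P = {}) \<and>
      orthonormal_on {..<N} w \<and> (\<forall>j<N. \<forall>v\<in>P. cinner v (w j) = 0) \<and> e k \<in> cspan (P \<union> w ` {..<N}) \<and>
      (\<forall>j<N. \<exists>z. norm z = 1 \<and> Q (k * N + j) z \<and> norm (w j - z) \<le> 2 / sqrt N))"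
    for k :: nat and s :: "'h set \<times> (nat \<Rightarrow> 'h)"
  have block: "\<exists>w. inv k (P, w)" if "finite P" "orthonormal_on P (\<lambda>v. v)" "k = 0 \<longrightarrow> P = {}" for k P
    using orthonormal_block[of "\<lambda>j. Q (k * N + j)" P N "e k", OF Q that(1,2) N] that
    unfolding inv_def by simp
  have "\<exists>s. \<forall>k. inv k (s k) \<and> fst (s (Suc k)) = fst (s k) \<union> snd (s k) ` {..<N}"
  proof (rule dependent_nat_choice)
    show "\<exists>s. inv 0 s"
      using block[of "{}" 0] by (auto simp: orthonormal_on_def)
    fix s k assume s: "inv k s"
    obtain P w where Pw: "s = (P, w)"
      by fastforce
    have "orthonormal_on (P \<union> w ` {..<N}) (\<lambda>v. v)"
    proof -
      have "cinner (w i) (w j) = (if w i = w j then 1 else 0)" if "i < N" "j < N" for i j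
        using s that orthonormal_onD[of "{..<N}" w i j] orthonormal_onD[of "{..<N}" w i i]
        by (auto simp: inv_def Pw)
      moreover have "cinner v (w j) = 0" "cinner (w j) v = 0" "w j \<noteq> v" "v \<noteq> w j" if "v \<in> P" "j < N" for v j
      proof -
        show 1: "cinner v (w j) = 0"
          using s that by (auto simp: inv_def Pw)
        then show "cinner (w j) v = 0"
          by (simp add: cinner_eq_0_commute)
        show "w j \<noteq> v" "v \<noteq> w j"
          using s 1 that orthonormal_onD[of "{..<N}" w j j] by (auto simp: inv_def Pw)
      qed
      ultimately show ?thesis
        using s by (auto simp: inv_def Pw orthonormal_on_def)
    qed
    then obtain w' where "inv (Suc k) (P \<union> w ` {..<N}, w')"
      using block[of "P \<union> w ` {..<N}" "Suc k"] s by (auto simp: inv_def Pw)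
    then show "\<exists>s'. inv (Suc k) s' \<and> fst s' = fst s \<union> snd s ` {..<N}"
      by (force simp: Pw)
  qed
  then obtain s where s: "\<And>k. inv k (s k)" "\<And>k. fst (s (Suc k)) = fst (s k) \<union> snd (s k) ` {..<N}"
    by blast
  define P where "P k = fst (s k)" for k
  define w where "w k = snd (s k)" for k
  have P0: "P 0 = {}" and on: "orthonormal_on {..<N} (w k)"
    and orth: "j < N \<Longrightarrow> v \<in> P k \<Longrightarrow> cinner v (w k j) = 0"
    and ek: "e k \<in> cspan (P k \<union> w k ` {..<N})"
    and near: "j < N \<Longrightarrow> \<exists>z. norm z = 1 \<and> Q (k * N + j) z \<and> norm (w k j - z) \<le> 2 / sqrt N" for k j v
    using s(1)[of 0] s(1)[of k] by (auto simp: inv_def P_def w_def split: prod.splits)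
  have PSuc: "P (Suc k) = P k \<union> w k ` {..<N}" for k
    using s(2) by (simp add: P_def w_def)
  have Pmono: "P k \<subseteq> P l" if "k \<le> l" for k l
    using that by (rule lift_Suc_mono_le[rotated]) (auto simp: PSuc)
  \<comment> \<open>Position \<open>k * N + j\<close> of the sequence is member \<open>j\<close> of
    block \<open>k\<close>, matching the index of \<open>Q\<close> in \<open>inv\<close>.\<close>
  define y where "y n = w (n div N) (n mod N)" for n
  have mod: "n mod N < N" for n
    using N by simp
  have cross: "cinner (y m) (y n) = 0" if "m div N < n div N" for m n
  proof -
    have "y m \<in> P (Suc (m div N))"
      using mod by (auto simp: y_def PSuc)
    then have "y m \<in> P (n div N)"
      using Pmono[of "Suc (m div N)" "n div N"] that by auto
    then show ?thesis
      unfolding y_def[of n] by (rule orth[OF mod])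
  qed
  show thesis
  proof (rule that)
    show "orthonormal_on UNIV y"
      unfolding orthonormal_on_def
    proof (intro ballI)
      fix m n
      consider "m div N < n div N" | "n div N < m div N" | "m div N = n div N"
        by linarith
      then show "cinner (y m) (y n) = (if m = n then 1 else 0)"
      proof cases
        case 1
        then show ?thesis
          using cross by auto
      next
        case 2
        then show ?thesis
          using cross[OF 2] cinner_eq_0_commute[of "y m" "y n"] by auto
      next
        case 3
        then have "m = n \<longleftrightarrow> m mod N = n mod N"
          by (metis div_mult_mod_eq)
        then show ?thesis
          using orthonormal_onD[OF on, of "m mod N" "n mod N" "m div N"] mod 3 by (simp add: y_def)
      qed
    qed
    have wy: "w k ` {..<N} \<subseteq> range y" for k
    proof clarify
      fix j assume "j < N"
      then have "w k j = y (k * N + j)"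
        by (simp add: y_def)
      then show "w k j \<in> range y"
        by simp
    qed
    have Py: "P k \<subseteq> range y" for k
      by (induction k) (use wy in \<open>auto simp: P0 PSuc\<close>)
    have "e k \<in> cspan (range y)" for k
      using ek[of k] complex_vector.span_mono[of "P k \<union> w k ` {..<N}" "range y"] wy Py by blast
    then have "cspan (range e) \<subseteq> cspan (range y)"
      by (intro complex_vector.span_minimal) auto
    then show "closure (cspan (range y)) = UNIV"
      using closure_mono e by blast
    show "\<exists>z. norm z = 1 \<and> Q n z \<and> norm (y n - z) \<le> 2 / sqrt (real N)" for n
      using near[where j = "n mod N" and k = "n div N"] mod by (simp add: y_def)
  qed
qed

section \<open>Unitaries from orthonormal bases\<close>

text \<open>\<open>U\<close> carries \<open>f\<close> to \<open>g\<close>, and the same construction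
  with the roles exchanged gives its inverse and adjoint. The conclusion speaks of
  \<open>adj_op U\<close> because the diagonal entry of a conjugate at \<open>b\<close> is the
  numerical value at \<open>adj_op U b\<close>.\<close>

lemma unitary_of_orthonormal_families:
  fixes f g :: "'i \<Rightarrow> 'h::complex_hilbert"
  assumes f: "orthonormal_on I f" "closure (cspan (f ` I)) = UNIV"
    and g: "orthonormal_on I g" "closure (cspan (g ` I)) = UNIV"
  obtains U where "unitary U" "\<And>i. i \<in> I \<Longrightarrow> adj_op U (g i) = f i"
proof -
  have bdd: "(\<Sum>i\<in>F. (cmod (cinner (h i) x))\<^sup>2) \<le> (1 * norm x)\<^sup>2"
    if "orthonormal_on I h" "finite F" "F \<subseteq> I" for h :: "'i \<Rightarrow> 'h" and F x
    using bessel_inequality[OF that] by simp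
  obtain U :: "'h \<Rightarrow>\<^sub>L 'h" where U: "U \<in> bounded_ops" "\<forall>j\<in>I. \<forall>x. cinner (g j) (U x) = cinner (f j) x"
    using synthesis_operator[OF g(1) zero_le_one bdd[OF f(1)]] by auto
  obtain V :: "'h \<Rightarrow>\<^sub>L 'h" where V: "V \<in> bounded_ops" "\<forall>j\<in>I. \<forall>x. cinner (f j) (V x) = cinner (g j) x"
    using synthesis_operator[OF f(1) zero_le_one bdd[OF g(1)]] by auto
  have UV: "cinner (U x) y = cinner x (V y)" for x y
  proof (rule adjointI[OF f(2) g(2) V(1) U(1)])
    fix a a' assume "a \<in> f ` I" "a' \<in> g ` I"
    then obtain i j where ij: "i \<in> I" "j \<in> I" "a = f i" "a' = g j"
      by blast
    have "cinner (U (f i)) (g j) = cnj (cinner (f j) (f i))"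
      using U(2) ij(2) cinner_commute[of "U (f i)" "g j"] by simp
    then show "cinner (U a) a' = cinner a (V a')"
      using ij f(1) g(1) by (simp add: V(2) orthonormal_onD)
  qed
  have VU: "V (U x) = x" for x
    by (rule total_cinner_eqI[OF f(2)]) (auto simp: V(2) U(2))
  have "U (V x) = x" for x
    by (rule total_cinner_eqI[OF g(2)]) (auto simp: V(2) U(2))
  then have "surj U"
    by (metis surjI)
  then have "unitary U"
    using U(1) by (simp add: unitary_def UV VU)
  moreover have "adj_op U = V"
  proof (rule adj_op_eqI[OF V(1)])
    show "cinner (V x) y = cinner x (U y)" for x y
      using UV[of y x] cinner_commute[of "V x" y] cinner_commute[of x "U y"] by simp
  qed
  moreover have "V (g i) = f i" if "i \<in> I" for i
    using f(1) g(1) that by (intro total_cinner_eqI[OF f(2)]) (auto simp: V(2) orthonormal_onD)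
  ultimately show thesis
    using that by simp
qed

lemma cinner_unitary_conjugate:
  fixes U T :: "'h::complex_hilbert \<Rightarrow>\<^sub>L 'h" and B :: "'h set"
  assumes B: "orthonormal_basis B" and U: "unitary U"
  shows "cinner x ((U o\<^sub>L T o\<^sub>L adj_op U) x) = cinner (adj_op U x) (T (adj_op U x))"
proof -
  have "U \<in> bounded_ops"
    using U by (simp add: unitary_def)
  then show ?thesis
    by (simp add: cinner_adj_op_left[OF B])
qed

lemma norm_adj_op_unitary:
  fixes U :: "'h::complex_hilbert \<Rightarrow>\<^sub>L 'h" and B :: "'h set"
  assumes B: "orthonormal_basis B" and U: "unitary U"
  shows "norm (adj_op U x) = norm x"
proof -
  have Ub: "U \<in> bounded_ops" and iso: "cinner (U y) (U z) = cinner y z" for y z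
    using U by (simp_all add: unitary_def)
  obtain z where z: "x = U z"
    using U unfolding unitary_def by (metis surjD)
  have "adj_op U (U z) = z"
    by (rule cinner_eqI) (simp add: cinner_adj_op_right[OF B Ub] iso)
  moreover have "norm (U z) = norm z"
    by (metis Re_cinner iso norm_eq_sqrt_inner)
  ultimately show ?thesis
    by (simp add: z)
qed

lemma unitary_orbit_bounded_ops:
  fixes U T :: "'h::complex_hilbert \<Rightarrow>\<^sub>L 'h" and B :: "'h set"
  assumes B: "orthonormal_basis B" and "unitary U" "T \<in> bounded_ops"
  shows "U o\<^sub>L T o\<^sub>L adj_op U \<in> bounded_ops"
  using assms(2,3) by (simp add: bounded_ops_compose adj_op_bounded_ops[OF B] unitary_def)

section \<open>Estimates for tuples and numerical values\<close>

lemma norm_le_tuple_norm: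
  fixes A :: "('h::complex_hilbert \<Rightarrow>\<^sub>L 'h) ^ 'n"
  shows "norm (A $ i) \<le> tuple_norm A"
  unfolding tuple_norm_def by (rule Max_ge) auto

lemma tuple_norm_less_iff:
  fixes A :: "('h::complex_hilbert \<Rightarrow>\<^sub>L 'h) ^ 'n"
  shows "tuple_norm A < e \<longleftrightarrow> (\<forall>i. norm (A $ i) < e)"
  unfolding tuple_norm_def by (subst Max_less_iff) auto

lemma numerical_value_diff_le:
  fixes T :: "'h::complex_hilbert \<Rightarrow>\<^sub>L 'h"
  assumes "norm x = 1" "norm y = 1"
  shows "cmod (cinner x (T x) - cinner y (T y)) \<le> 2 * norm T * norm (x - y)"
proof -
  have "cinner x (T x) - cinner y (T y) = cinner x (T (x - y)) + cinner (x - y) (T y)"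
    by (simp add: blinfun.diff_right cinner.diff_left cinner.diff_right)
  also have "cmod \<dots> \<le> norm x * norm (T (x - y)) + norm (x - y) * norm (T y)"
    by (intro norm_triangle_le add_mono cmod_cinner_le)
  also have "\<dots> \<le> norm x * (norm T * norm (x - y)) + norm (x - y) * (norm T * norm y)"
    by (intro add_mono mult_left_mono norm_blinfun) auto
  finally show ?thesis
    by (simp add: assms mult.commute mult.left_commute)
qed

lemma atomic_masa_hermitian:
  fixes T :: "'h::complex_hilbert \<Rightarrow>\<^sub>L 'h"
  assumes B: "orthonormal_basis B" and T: "T \<in> atomic_masa B"
    and real: "\<And>b. b \<in> B \<Longrightarrow> cnj (cinner b (T b)) = cinner b (T b)"
  shows "hermitian T"
proof -
  note tot = orthonormal_basis_total[OF B]
  have Tb: "T \<in> bounded_ops"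
    using T by (simp add: atomic_masa_def)
  have "cinner (T x) y = cinner x (T y)" for x y
  proof (rule adjointI[OF tot tot Tb Tb])
    fix b b' assume b: "b \<in> B" "b' \<in> B"
    have "cinner (T b) b' = cnj (cinner b (T b)) * cinner b b'"
      by (subst atomic_masa_basis[OF B T b(1)]) (simp add: cinner_scaleC_left)
    moreover have "cinner b (T b') = cinner b' (T b') * cinner b b'"
      by (subst atomic_masa_basis[OF B T b(2)]) (simp add: cinner_scaleC_right)
    ultimately show "cinner (T b) b' = cinner b (T b')"
      using real[OF b(1)] orthonormal_basis_cinner[OF B b] by auto
  qed
  then show ?thesis
    using Tb by (simp add: hermitian_def)
qed

section \<open>Cardinality of orthonormal bases\<close>

lemma infinite_orthonormal_basis:
  fixes B :: "'h::complex_hilbert set"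
  assumes B: "orthonormal_basis B" and inf: "\<not> finite_cdim (UNIV :: 'h set)"
  shows "infinite B"
proof
  assume fin: "finite B"
  have "x \<in> cspan B" for x
  proof -
    have "x = (\<Sum>b\<in>B. cinner b x *\<^sub>C b)"
      by (rule orthonormal_basis_cinner_eqI[OF B])
        (simp add: cinner_sum_right_orthonormal[OF orthonormal_basis_orthonormal_on[OF B] fin subset_refl])
    then show ?thesis
      by (metis (no_types, lifting) complex_vector.span_sum complex_vector.span_scale complex_vector.span_base)
  qed
  then show False
    using inf fin by (auto simp: finite_cdim_def)
qed

text \<open>Distinct basis vectors are sqrt 2 apart, so no point of a dense set is within 1 / 2 of
  two of them; choosing a nearby point embeds \<open>B\<close> into a countable set.\<close>

lemma countable_orthonormal_basis:
  fixes B :: "'h::complex_hilbert set"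
  assumes B: "orthonormal_basis B" and sep: "separable_space (euclidean :: 'h topology)"
  shows "countable B"
proof -
  obtain D :: "'h set" where D: "countable D" "closure D = UNIV"
    using sep by (auto simp: separable_space_def)
  have "\<exists>d\<in>D. dist d b < 1 / 2" for b
    using D(2) closure_approachable[of b D] half_gt_zero[OF zero_less_one] by blast
  then obtain d where d: "\<And>b. d b \<in> D" "\<And>b. dist (d b) b < 1 / 2"
    by metis
  have "inj_on d B"
  proof (rule inj_onI, rule ccontr)
    fix b b' assume b: "b \<in> B" "b' \<in> B" "d b = d b'" "b \<noteq> b'"
    have "dist b b' < 1"
      using d(2)[of b] d(2)[of b'] b(3) by (metis dist_commute dist_triangle_half_l)
    moreover have "(dist b b')\<^sup>2 = 2"
    proof -
      have "inner b b' = 0" "inner b b = 1" "inner b' b' = 1"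
        using orthonormal_basis_cinner[OF B] b by (simp_all flip: Re_cinner)
      then show ?thesis
        unfolding dist_norm power2_norm_eq_inner
        by (simp only: inner_diff_left inner_diff_right inner_commute[of b' b])
    qed
    ultimately show False
      using power_mono[of "dist b b'" 1 2] by simp
  qed
  moreover have "countable (d ` B)"
    using D(1) d(1) by (meson countable_subset image_subsetI)
  ultimately show ?thesis
    by (metis countable_image_inj_on)
qed

section \<open>The closure of the compressed unitary orbit\<close>

text \<open>Everything is passed to the limit through diagonal entries: the algebra is closed,
  limits of real entries are real, and the vectors of entries stay in the closed set
  \<open>C\<close>. The joint spectrum is dealt with only for the limit, from its entries.\<close>

lemma closure_compressed_orbit_subset:
  fixes B :: "'h::complex_hilbert set" and S :: "('h \<Rightarrow>\<^sub>L 'h) ^ 'n"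
  assumes B: "orthonormal_basis B" and S: "\<And>i. hermitian (S $ i)"
    and commute: "\<And>i j. S $ i o\<^sub>L S $ j = S $ j o\<^sub>L S $ i"
    and C: "closed C" "convex C" "joint_spectrum S \<subseteq> C"
    and A: "A \<in> tuple_closure ((\<lambda>T. \<chi> i. diag_compression B (T $ i)) ` unitary_orbit S)"
  shows "A $ i \<in> atomic_masa B" "hermitian (A $ i)" "joint_spectrum A \<subseteq> C"
proof -
  have "\<exists>U. unitary U \<and> tuple_norm (A - (\<chi> i. diag_compression B (U o\<^sub>L S $ i o\<^sub>L adj_op U))) < 1 / real (Suc k)" for k
  proof -
    have "1 / real (Suc k) > 0"
      by simp
    then obtain T where "T \<in> unitary_orbit S" "tuple_norm (A - (\<chi> i. diag_compression B (T $ i))) < 1 / real (Suc k)"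
      using A unfolding tuple_closure_def by blast
    then show ?thesis
      unfolding unitary_orbit_def by fastforce
  qed
  then obtain U where U: "\<And>k. unitary (U k)"
    "\<And>k. tuple_norm (A - (\<chi> i. diag_compression B (U k o\<^sub>L S $ i o\<^sub>L adj_op (U k)))) < 1 / real (Suc k)"
    by metis
  define D where "D k i = diag_compression B (U k o\<^sub>L S $ i o\<^sub>L adj_op (U k))" for k i
  define v where "v k b = (\<chi> i. Re (cinner (adj_op (U k) b) ((S $ i) (adj_op (U k) b))))" for k b
  have Ub: "U k o\<^sub>L S $ i o\<^sub>L adj_op (U k) \<in> bounded_ops" for k i
    using S by (intro unitary_orbit_bounded_ops[OF B U(1)]) (simp add: hermitian_def)
  have Db: "D k i b = complex_of_real (v k b $ i) *\<^sub>C b" if b: "b \<in> B" for k i b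
  proof -
    have "D k i b = cinner (adj_op (U k) b) ((S $ i) (adj_op (U k) b)) *\<^sub>C b"
      unfolding D_def by (simp only: diag_compression_basis[OF B Ub b] cinner_unitary_conjugate[OF B U(1)])
    then show ?thesis
      using cinner_hermitian_real[OF S, of "adj_op (U k) b"] by (simp add: v_def)
  qed
  have vC: "v k b \<in> C" if "b \<in> B" for k b
    unfolding v_def using orthonormal_basis_norm[OF B that]
    by (intro joint_numerical_range_subset[OF B S commute _ C]) (simp add: norm_adj_op_unitary[OF B U(1)])
  have Dlim: "(\<lambda>k. D k i) \<longlonglongrightarrow> A $ i" for i
  proof -
    have le: "norm (D k i - A $ i) \<le> 1 / real (Suc k)" for k
    proof -
      have "norm ((A - (\<chi> i. D k i)) $ i) < 1 / real (Suc k)"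
        unfolding D_def by (rule le_less_trans[OF norm_le_tuple_norm U(2)])
      then show ?thesis
        by (simp only: vector_minus_component vec_lambda_beta norm_minus_commute[of "A $ i"] less_imp_le)
    qed
    have "(\<lambda>k. 1 / real (Suc k)) \<longlonglongrightarrow> 0"
      using LIMSEQ_inverse_real_of_nat by (simp only: inverse_eq_divide)
    then have "(\<lambda>k. D k i - A $ i) \<longlonglongrightarrow> 0"
      by (rule Lim_null_comparison[rotated]) (simp only: le eventually_True)
    then show ?thesis
      by (simp add: LIM_zero_iff)
  qed
  have Dmasa: "D k i \<in> atomic_masa B" for k i
    using Db diag_compression_bounded_ops[OF B Ub] unfolding atomic_masa_def by (auto simp: D_def)
  have masa: "A $ i \<in> atomic_masa B" for i
    using unital_cstar_subalgebra_atomic_masa[OF B]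
    by (intro closed_sequentially[OF _ Dmasa Dlim]) (simp add: unital_cstar_subalgebra_def)
  have vlim: "(\<lambda>k. complex_of_real (v k b $ i)) \<longlonglongrightarrow> cinner b ((A $ i) b)" if b: "b \<in> B" for b i
  proof -
    have "(\<lambda>k. cinner b (D k i b)) \<longlonglongrightarrow> cinner b ((A $ i) b)"
      by (intro cinner.tendsto blinfun.tendsto Dlim tendsto_const)
    then show ?thesis
      by (simp add: Db[OF b] cinner_scaleC_right orthonormal_basis_cinner[OF B b b])
  qed
  have herm: "hermitian (A $ i)" for i
  proof (rule atomic_masa_hermitian[OF B masa])
    fix b assume b: "b \<in> B"
    from tendsto_cnj[OF vlim[OF b]] have "(\<lambda>k. complex_of_real (v k b $ i)) \<longlonglongrightarrow> cnj (cinner b ((A $ i) b))"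
      by simp
    with vlim[OF b] show "cnj (cinner b ((A $ i) b)) = cinner b ((A $ i) b)"
      by (rule LIMSEQ_unique[rotated])
  qed
  have "(\<chi> i. Re (cinner b ((A $ i) b))) \<in> C" if b: "b \<in> B" for b
  proof (rule closed_sequentially[OF C(1) vC[OF b]])
    show "(\<lambda>k. v k b) \<longlonglongrightarrow> (\<chi> i. Re (cinner b ((A $ i) b)))"
    proof (rule vec_tendstoI)
      show "(\<lambda>k. v k b $ i) \<longlonglongrightarrow> (\<chi> i. Re (cinner b ((A $ i) b))) $ i" for i
        using tendsto_Re[OF vlim[OF b]] by simp
    qed
  qed
  then show "A $ i \<in> atomic_masa B" "hermitian (A $ i)" "joint_spectrum A \<subseteq> C"
    using masa herm joint_spectrum_subset_convex[OF B masa herm C(1,2)] by auto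
qed

lemma diagonal_in_closure_compressed_orbit:
  fixes B :: "'h::complex_hilbert set" and S :: "('h \<Rightarrow>\<^sub>L 'h) ^ 'n"
  assumes B: "orthonormal_basis B" "countable B" "infinite B" and S: "\<And>i. hermitian (S $ i)"
    and X: "finite X" "\<And>\<mu>. \<mu> \<in> X \<Longrightarrow> \<not> finite_cdim (joint_eigenspace S \<mu>)"
    and A: "\<And>i. A $ i \<in> atomic_masa B" "\<And>i. hermitian (A $ i)" "joint_spectrum A \<subseteq> convex hull X"
  shows "A \<in> tuple_closure ((\<lambda>T. \<chi> i. diag_compression B (T $ i)) ` unitary_orbit S)"
proof -
  note B1 = B(1)
  define p where "p b = (\<chi> i. Re (cinner b ((A $ i) b)))" for b
  have p: "p b \<in> convex hull X" if "b \<in> B" for b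
    using diagonal_in_joint_spectrum[OF B1 that A(1,2)] A(3) by (auto simp: p_def)
  define b where "b = from_nat_into B"
  have b: "bij_betw b UNIV B"
    unfolding b_def using B(2,3) by (rule bij_betw_from_nat_into)
  have bB: "b n \<in> B" "range b = B" for n
    using b by (auto simp: bij_betw_def)
  have on_b: "orthonormal_on UNIV b"
    using orthonormal_basis_cinner[OF B1 bB(1) bB(1)] b
    by (auto simp: orthonormal_on_def bij_betw_def inj_eq)
  have tot_b: "closure (cspan (range b)) = UNIV"
    unfolding bB(2) by (rule orthonormal_basis_total[OF B1])
  have "\<exists>T\<in>(\<lambda>T. \<chi> i. diag_compression B (T $ i)) ` unitary_orbit S. tuple_norm (A - T) < e" if e: "e > 0" for e
  proof -
    define M where "M = (\<Sum>i\<in>UNIV. norm (S $ i))"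
    have M: "norm (S $ i) \<le> M" "M \<ge> 0" for i
      unfolding M_def by (auto intro: member_le_sum sum_nonneg)
    \<comment> \<open>A displacement of \<open>2 / sqrt N\<close> changes a numerical value of
      \<open>S $ i\<close> by at most \<open>2 * M\<close> times as much, with \<open>M\<close> a
      common bound for the norms.\<close>
    have "(\<lambda>N. 4 * M / sqrt (real N)) \<longlonglongrightarrow> 0"
      by (intro tendsto_divide_0[OF tendsto_const] filterlim_at_top_imp_at_infinity
          filterlim_compose[OF sqrt_at_top filterlim_real_sequentially])
    then have "\<forall>\<^sub>F N in sequentially. 4 * M / sqrt (real N) < e \<and> N > 0"
      using e by (intro eventually_conj order_tendstoD eventually_gt_at_top) auto
    then obtain N where N: "N > 0" "4 * M / sqrt (real N) < e"
      using eventually_happens'[OF sequentially_bot] by blast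
    \<comment> \<open>The value is demanded exactly of the nearby vector \<open>z\<close>; only its
      displaced version \<open>y n\<close> enters the basis.\<close>
    define Q where "Q n z \<longleftrightarrow> (\<forall>i. cinner z ((S $ i) z) = complex_of_real (p (b n) $ i))" for n z
    have "\<exists>z. norm z = 1 \<and> (\<forall>v\<in>F. cinner v z = 0) \<and> Q n z" if "finite F" for F n
      by (rule convex_hull_numerical_value[OF S X p[OF bB(1)] that]) (auto simp: Q_def)
    then obtain y where y: "orthonormal_on UNIV y" "closure (cspan (range y)) = UNIV"
      "\<And>n. \<exists>z. norm z = 1 \<and> Q n z \<and> norm (y n - z) \<le> 2 / sqrt (real N)"
      using orthonormal_sequence_total[OF tot_b N(1), of Q] by metis
    obtain U where U: "unitary U" "\<And>n. adj_op U (b n) = y n"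
      using unitary_of_orthonormal_families[OF y(1,2) on_b tot_b] by auto
    define T where "T i = U o\<^sub>L S $ i o\<^sub>L adj_op U" for i
    have Tb: "T i \<in> bounded_ops" for i
      unfolding T_def using S by (intro unitary_orbit_bounded_ops[OF B1 U(1)]) (simp add: hermitian_def)
    have "norm (A $ i - diag_compression B (T i)) \<le> 4 * M / sqrt (real N)" for i
    proof (rule norm_diagonal_le[OF B1])
      let ?d = "\<lambda>b. cinner b ((A $ i) b) - cinner b (T i b)"
      show "0 \<le> 4 * M / sqrt (real N)"
        using M(2) by simp
      show "A $ i - diag_compression B (T i) \<in> bounded_ops"
        using A(1) by (intro bounded_ops_diff diag_compression_bounded_ops[OF B1 Tb]) (simp add: atomic_masa_def)
      fix c assume c: "c \<in> B"
      show "(A $ i - diag_compression B (T i)) c = ?d c *\<^sub>C c"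
        using atomic_masa_basis[OF B1 A(1) c, of i]
        by (simp add: blinfun.diff_left diag_compression_basis[OF B1 Tb c] scaleC.diff_left)
      obtain n where n: "c = b n"
        using c bB(2) by blast
      obtain z where z: "norm z = 1" "Q n z" "norm (y n - z) \<le> 2 / sqrt (real N)"
        using y(3) by blast
      have "cinner c ((A $ i) c) = cinner z ((S $ i) z)"
        using z(2) cinner_hermitian_real[OF A(2), of c i] by (simp add: Q_def p_def n)
      moreover have "cinner c (T i c) = cinner (y n) ((S $ i) (y n))"
        unfolding T_def cinner_unitary_conjugate[OF B1 U(1)] by (simp only: n U(2))
      ultimately have "cmod (?d c) \<le> 2 * norm (S $ i) * norm (y n - z)"
        using numerical_value_diff_le[OF z(1) orthonormal_on_norm[OF y(1) UNIV_I], of "S $ i" n]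
        by (simp add: norm_minus_commute)
      also have "\<dots> \<le> 2 * M * (2 / sqrt (real N))"
        using M z(3) by (intro mult_mono) auto
      finally show "cmod (?d c) \<le> 4 * M / sqrt (real N)"
        by simp
    qed
    then have "tuple_norm (A - (\<chi> i. diag_compression B ((\<chi> i. T i) $ i))) < e"
      using N(2) le_less_trans by (auto simp: tuple_norm_less_iff)
    moreover have "(\<chi> i. T i) \<in> unitary_orbit S"
      unfolding unitary_orbit_def T_def using U(1) by blast
    ultimately show ?thesis
      by blast
  qed
  moreover have "A $ i \<in> bounded_ops" for i
    using A(1) by (simp add: atomic_masa_def)
  ultimately show ?thesis
    by (simp add: tuple_closure_def)
qed

theorem theorem11:
  fixes B :: "'h::complex_hilbert set"
    and S :: "('h \<Rightarrow>\<^sub>L 'h) ^ 'n"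
    and X C :: "(real ^ 'n) set"
  assumes separable: "separable_space (euclidean :: 'h topology)"
    and infinite_dim: "\<not> finite_cdim (UNIV :: 'h set)"
    and basis: "orthonormal_basis B"
    and hermitian: "\<forall>i. hermitian (S $ i)"
    and commuting: "\<forall>i j. S $ i o\<^sub>L S $ j = S $ j o\<^sub>L S $ i"
    and spectrum: "joint_spectrum S = X"
    and finite: "finite X"
    and infinite_mult: "\<forall>\<mu>\<in>X. \<not> finite_cdim (joint_eigenspace S \<mu>)"
    and polytope: "polytope C"
    and vertices: "X = {v. v extreme_point_of C}"
  shows "tuple_closure ((\<lambda>T. \<chi> i. diag_compression B (T $ i)) ` unitary_orbit S) =
    {A. (\<forall>i. A $ i \<in> atomic_masa B \<and> hermitian (A $ i)) \<and> joint_spectrum A \<subseteq> C}"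
proof (intro set_eqI iffI)
  have C: "closed C" "convex C"
    using polytope polytope_imp_compact polytope_imp_convex compact_imp_closed by blast+
  \<comment> \<open>The spectrum recovers \<open>C\<close>: one inclusion needs only that
    \<open>X\<close> lies in \<open>C\<close>, the other writes points of \<open>C\<close> as convex
    combinations of spectral points.\<close>
  have hull: "C = convex hull X"
    unfolding vertices
    by (rule Krein_Milman_Minkowski[OF polytope_imp_compact[OF polytope] polytope_imp_convex[OF polytope]])
  have spec: "joint_spectrum S \<subseteq> C"
    unfolding spectrum hull by (rule hull_subset)
  fix A
  show "A \<in> {A. (\<forall>i. A $ i \<in> atomic_masa B \<and> hermitian (A $ i)) \<and> joint_spectrum A \<subseteq> C}"
    if "A \<in> tuple_closure ((\<lambda>T. \<chi> i. diag_compression B (T $ i)) ` unitary_orbit S)"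
    using closure_compressed_orbit_subset[OF basis _ _ C spec that] hermitian commuting by simp
  show "A \<in> tuple_closure ((\<lambda>T. \<chi> i. diag_compression B (T $ i)) ` unitary_orbit S)"
    if A: "A \<in> {A. (\<forall>i. A $ i \<in> atomic_masa B \<and> hermitian (A $ i)) \<and> joint_spectrum A \<subseteq> C}"
  proof (rule diagonal_in_closure_compressed_orbit[OF basis _ _ _ finite])
    show "countable B"
      by (rule countable_orthonormal_basis[OF basis separable])
    show "infinite B"
      by (rule infinite_orthonormal_basis[OF basis infinite_dim])
    show "joint_spectrum A \<subseteq> convex hull X"
      using A unfolding hull by blast
  qed (use A hermitian infinite_mult in simp_all)
qed

end
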